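(* Let $K=\mathbb Q_p$ or $K=\mathbb C_p$, viewed as a structure in the additive affine-valuative language $L_K=\{0,+,-,(\lambda\cdot)_{\lambda\in K},<_v\}$. Let $r,t\ge2$ and fix a definable $r$-partite relation $R\subseteq K^{d_1}\times\cdots\times K^{d_r}$. Then for all finite $B_j\subseteq K^{d_j}$ ($1\le j\le r$) such that the trace $E=R\cap(B_1\times\cdots\times B_r)$ is $K_{t,\ldots,t}$-free, $$|E|=O\bigl(n^{r-1}(\log n)^c\bigr),\qquad n=\sum_{j}|B_j|,$$ where the implied constant and $c$ depend only on the defining formula of $R$, on $r$ and on $t$.
   Context: $p$ is a prime, $v$ is the $p$-adic valuation on $K$ with $v(0)=\infty$, $\lambda\cdot$ denotes the unary function $x\mapsto\lambda x$, and $a<_v b$ means $v(a)<v(b)$. The structure is one-sorted with universe $K$, and "definable" means defined by an $L_K$-formula with parameters from $K$. $E\subseteq B_1\times\cdots\times B_r$ is $K_{t,\ldots,t}$-free if there are no $T_j\subseteq B_j$ with $|T_j|=t$ for all $j$ and $T_1\times\cdots\times T_r\subseteq E$. *)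

theory Defs
  imports
    Complex_Main
    "HOL-Library.FuncSet"
    "HOL-Library.Extended_Real"
    "HOL-Computational_Algebra.Computational_Algebra"
begin

section \<open>The valued fields \<open>Q\<^sub>p\<close> and \<open>C\<^sub>p\<close>\<close>

text \<open>
  Both fields are given by their defining descriptions, \<open>Q\<^sub>p\<close> as the completion of the rationals
  and \<open>C\<^sub>p\<close> as the completion of an algebraic closure of \<open>Q\<^sub>p\<close>.  These determine the valued field
  up to a unique isomorphism, resp. up to isomorphism.
\<close>

definition valuation :: "('a::field \<Rightarrow> ereal) \<Rightarrow> bool" where
  "valuation v \<longleftrightarrow>
     (\<forall>x. v x = \<infinity> \<longleftrightarrow> x = 0) \<and> (\<forall>x. v x \<noteq> -\<infinity>) \<and>
     (\<forall>x y. v (x * y) = v x + v y) \<and>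
     (\<forall>x y. min (v x) (v y) \<le> v (x + y))"

definition padic_valuation :: "nat \<Rightarrow> ('a::field_char_0 \<Rightarrow> ereal) \<Rightarrow> bool" where
  "padic_valuation p v \<longleftrightarrow> valuation v \<and>
     (\<forall>n::nat. n > 0 \<longrightarrow> v (of_nat n) = ereal (real (multiplicity p n)))"

definition subfield_of :: "'a::field set \<Rightarrow> bool" where
  "subfield_of F \<longleftrightarrow> 1 \<in> F \<and>
     (\<forall>x\<in>F. \<forall>y\<in>F. x - y \<in> F \<and> x * y \<in> F) \<and> (\<forall>x\<in>F. inverse x \<in> F)"

definition v_Cauchy :: "('a::field \<Rightarrow> ereal) \<Rightarrow> (nat \<Rightarrow> 'a) \<Rightarrow> bool" where
  "v_Cauchy v X \<longleftrightarrow> (\<forall>N::real. \<exists>M. \<forall>m\<ge>M. \<forall>n\<ge>M. v (X m - X n) > ereal N)"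

definition v_converges :: "('a::field \<Rightarrow> ereal) \<Rightarrow> (nat \<Rightarrow> 'a) \<Rightarrow> 'a \<Rightarrow> bool" where
  "v_converges v X l \<longleftrightarrow> (\<forall>N::real. \<exists>M. \<forall>n\<ge>M. v (X n - l) > ereal N)"

definition v_complete :: "('a::field \<Rightarrow> ereal) \<Rightarrow> 'a set \<Rightarrow> bool" where
  "v_complete v S \<longleftrightarrow>
     (\<forall>X. range X \<subseteq> S \<and> v_Cauchy v X \<longrightarrow> (\<exists>l\<in>S. v_converges v X l))"

definition v_dense :: "('a::field \<Rightarrow> ereal) \<Rightarrow> 'a set \<Rightarrow> 'a set \<Rightarrow> bool" where
  "v_dense v D S \<longleftrightarrow> (\<forall>x\<in>S. \<forall>N::real. \<exists>y\<in>D. v (x - y) > ereal N)"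

definition completion_of :: "('a::field \<Rightarrow> ereal) \<Rightarrow> 'a set \<Rightarrow> 'a set \<Rightarrow> bool" where
  "completion_of v D S \<longleftrightarrow>
     subfield_of D \<and> subfield_of S \<and> D \<subseteq> S \<and> v_dense v D S \<and> v_complete v S"

definition algebraic_closure_of :: "'a::field set \<Rightarrow> 'a set \<Rightarrow> bool" where
  "algebraic_closure_of F A \<longleftrightarrow>
     subfield_of F \<and> subfield_of A \<and> F \<subseteq> A \<and>
     (\<forall>x\<in>A. \<exists>q. q \<noteq> 0 \<and> (\<forall>i. coeff q i \<in> F) \<and> poly q x = 0) \<and>
     (\<forall>q. degree q > 0 \<and> (\<forall>i. coeff q i \<in> A) \<longrightarrow> (\<exists>x\<in>A. poly q x = 0))"

text \<open>The field \<open>K\<close> is the whole type \<open>'a\<close>.\<close>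

definition is_Qp :: "nat \<Rightarrow> ('a::field_char_0 \<Rightarrow> ereal) \<Rightarrow> bool" where
  "is_Qp p v \<longleftrightarrow> padic_valuation p v \<and> completion_of v \<rat> UNIV"

definition is_Cp :: "nat \<Rightarrow> ('a::field_char_0 \<Rightarrow> ereal) \<Rightarrow> bool" where
  "is_Cp p v \<longleftrightarrow> padic_valuation p v \<and>
     (\<exists>F A. completion_of v \<rat> F \<and> algebraic_closure_of F A \<and> completion_of v A UNIV)"

section \<open>The language \<open>L\<^sub>K = {0, +, -, (\<lambda>\<cdot>)\<^sub>\<lambda>\<^sub>\<in>\<^sub>K, <\<^sub>v}\<close>\<close>

datatype 'a lterm =
    LVar nat
  | LZero
  | LAdd "'a lterm" "'a lterm"
  | LMinus "'a lterm"
  | LScale 'a "'a lterm"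

datatype 'a lform =
    LEq "'a lterm" "'a lterm"
  | LLess "'a lterm" "'a lterm"
  | LNeg "'a lform"
  | LConj "'a lform" "'a lform"
  | LEx nat "'a lform"

primrec lterm_val :: "(nat \<Rightarrow> 'a::field) \<Rightarrow> 'a lterm \<Rightarrow> 'a" where
  "lterm_val e (LVar i) = e i"
| "lterm_val e LZero = 0"
| "lterm_val e (LAdd s u) = lterm_val e s + lterm_val e u"
| "lterm_val e (LMinus s) = - lterm_val e s"
| "lterm_val e (LScale a s) = a * lterm_val e s"

primrec lsat :: "('a::field \<Rightarrow> ereal) \<Rightarrow> (nat \<Rightarrow> 'a) \<Rightarrow> 'a lform \<Rightarrow> bool" where
  "lsat v e (LEq s u) \<longleftrightarrow> lterm_val e s = lterm_val e u"
| "lsat v e (LLess s u) \<longleftrightarrow> v (lterm_val e s) < v (lterm_val e u)"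
| "lsat v e (LNeg \<phi>) \<longleftrightarrow> \<not> lsat v e \<phi>"
| "lsat v e (LConj \<phi> \<psi>) \<longleftrightarrow> lsat v e \<phi> \<and> lsat v e \<psi>"
| "lsat v e (LEx i \<phi>) \<longleftrightarrow> (\<exists>a. lsat v (e(i := a)) \<phi>)"

section \<open>Definable \<open>r\<close>-partite relations\<close>

text \<open>
  A point of \<open>K\<^sup>d\<close> is a list of length \<open>d\<close>; an element of \<open>B\<^sub>1 \<times> \<dots> \<times> B\<^sub>r\<close> is an extensional
  function on the index set \<open>{..<r}\<close> (indices start at 0).
\<close>

definition Kpow :: "nat \<Rightarrow> 'a list set" where
  "Kpow d = {xs. length xs = d}"

text \<open>
  A formula \<open>\<phi>(x\<^sub>1, \<dots>, x\<^sub>r; y)\<close> has the coordinates of \<open>x\<^sub>1, \<dots>, x\<^sub>r\<close>, in this order, as its variables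
  \<open>0, \<dots>, d\<^sub>1 + \<dots> + d\<^sub>r - 1\<close>; all further free variables (finitely many, since \<open>\<phi>\<close> is finite) form the
  tuple \<open>y\<close>, into which the parameters \<open>b\<close> from \<open>K\<close> are substituted.
\<close>

definition assignment :: "'a list \<Rightarrow> (nat \<Rightarrow> 'a) \<Rightarrow> nat \<Rightarrow> 'a" where
  "assignment xs b i = (if i < length xs then xs ! i else b (i - length xs))"

definition relation_of ::
  "('a::field \<Rightarrow> ereal) \<Rightarrow> nat \<Rightarrow> (nat \<Rightarrow> nat) \<Rightarrow> 'a lform \<Rightarrow> (nat \<Rightarrow> 'a) \<Rightarrow> (nat \<Rightarrow> 'a list) set" where
  "relation_of v r d \<phi> b =
     {x \<in> (\<Pi>\<^sub>E j\<in>{..<r}. Kpow (d j)). lsat v (assignment (concat (map x [0..<r])) b) \<phi>}"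

definition defined_by ::
  "('a::field \<Rightarrow> ereal) \<Rightarrow> nat \<Rightarrow> (nat \<Rightarrow> nat) \<Rightarrow> 'a lform \<Rightarrow> (nat \<Rightarrow> 'a list) set \<Rightarrow> bool" where
  "defined_by v r d \<phi> R \<longleftrightarrow> (\<exists>b. R = relation_of v r d \<phi> b)"

definition K_free :: "nat \<Rightarrow> nat \<Rightarrow> (nat \<Rightarrow> 'b set) \<Rightarrow> (nat \<Rightarrow> 'b) set \<Rightarrow> bool" where
  "K_free r t B E \<longleftrightarrow>
     \<not> (\<exists>T. (\<forall>j<r. T j \<subseteq> B j \<and> card (T j) = t) \<and> (\<Pi>\<^sub>E j\<in>{..<r}. T j) \<subseteq> E)"

end

theory Submission
  imports Defs
begin

text \<open>
  The whole proof is about fibres. Fix all points of an edge but one and let the remaining point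
  range over a finite set \<open>A\<close> of at most \<open>n\<close> points; the relation then cuts a subset, a fibre, out
  of \<open>A\<close>. Although there may be about \<open>n\<^sup>r\<^sup>-\<^sup>1\<close> fibres, all of them come from one \<^emph>\<open>range tree\<close>, in the sense
  of computational geometry: a family of subsets of \<open>A\<close>, of total size \<open>n\<close> times a power of \<open>log n\<close>,
  such that every fibre is the union of polylogarithmically many members.

  \<^emph>\<open>Range trees give the bound\<close> (\<open>card_K_free_le\<close>, induction on \<open>r\<close>). A pair of an edge and a member
  that covers its last point either involves a member with fewer than \<open>t\<close> points, and there are few
  such pairs because every fibre uses few members; or it involves a member \<open>S\<close> with at least \<open>t\<close>
  points. Choose \<open>t\<close> of them. Every \<open>(r - 1)\<close>-tuple whose fibre uses \<open>S\<close> lies in the intersection of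
  the \<open>t\<close> slices of the relation at the chosen points. That intersection is an \<open>(r - 1)\<close>-partite
  \<open>K\<^sub>t\<^sub>,\<^sub>\<dots>\<^sub>,\<^sub>t\<close>-free relation whose fibres come again from range trees, so that the induction hypothesis
  bounds the number of these tuples. Weighting them by the size of \<open>S\<close> costs only the total size of
  the tree.

  \<^emph>\<open>Comparisons have range trees\<close> (\<open>range_tree_compare\<close>). An atomic condition on the free point \<open>x\<close> is
  \<open>v (f x - a) < v (g x - b)\<close> with \<open>f\<close> and \<open>g\<close> depending only on \<open>x\<close> and \<open>a\<close>, \<open>b\<close> only on the fixed
  points. A finite ultrametric space has a linear order in which balls are intervals, and \<open>a\<close> has a
  place in that order. If \<open>S\<close> lies on one side of \<open>a\<close>, the extreme point \<open>s\<close> of \<open>S\<close> on the side of \<open>a\<close>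
  is a nearest one, and \<open>v (f x - a) = min (v (f x - f s)) (v (f s - a))\<close> for \<open>x\<close> in \<open>S\<close>: a function
  that does not depend on \<open>a\<close>, cut off at a constant. Hence both sides of the comparison become fixed
  functions or constants after a bounded number of cuts of linear orders, and cuts have range trees
  made of dyadic blocks. Range trees can be composed, which yields intersections and unions.

  \<^emph>\<open>Quantifiers can be eliminated\<close> (\<open>order_determined_lsat\<close>). The truth of a formula depends only on
  how the values of finitely many linear forms in its variables compare. This is a back-and-forth
  argument: if two assignments compare alike on a suitable larger set of linear forms, then for
  every value \<open>a\<close> of the quantified variable in the first one there is a corresponding value \<open>a'\<close> in
  the second one (\<open>point_transfer\<close>, \<open>eliminate_variable\<close>). The position of \<open>a\<close> is described by a
  nearest zero \<open>c\<close> of the forms involved and by the value of \<open>a - c\<close>; it is copied by distinguishing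
  whether the residue field has enough elements and whether the value group has gaps.
\<close>

section \<open>Range trees\<close>

definition range_tree :: "'x set \<Rightarrow> nat \<Rightarrow> 'x set set \<Rightarrow> bool" where
  "range_tree A p \<F> \<longleftrightarrow>
     (\<exists>\<S>. \<S> \<subseteq> Pow A \<and> finite \<S> \<and> (\<Sum>S\<in>\<S>. card S) \<le> p * card A \<and>
          (\<forall>F\<in>\<F>. \<exists>\<T>\<subseteq>\<S>. card \<T> \<le> p \<and> \<Union>\<T> = F))"

lemma range_treeI:
  assumes "\<S> \<subseteq> Pow A" "finite \<S>" "(\<Sum>S\<in>\<S>. card S) \<le> p * card A"
    and "\<And>F. F \<in> \<F> \<Longrightarrow> \<exists>\<T>\<subseteq>\<S>. card \<T> \<le> p \<and> \<Union>\<T> = F"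
  shows "range_tree A p \<F>"
proof -
  have "\<forall>F\<in>\<F>. \<exists>\<T>\<subseteq>\<S>. card \<T> \<le> p \<and> \<Union>\<T> = F" using assms(4) by (rule ballI)
  with assms(1-3) show ?thesis unfolding range_tree_def by (intro exI[of _ \<S>] conjI)
qed

lemma range_treeE:
  assumes "range_tree A p \<F>"
  obtains \<S> where "\<S> \<subseteq> Pow A" "finite \<S>" "(\<Sum>S\<in>\<S>. card S) \<le> p * card A"
    "\<And>F. F \<in> \<F> \<Longrightarrow> \<exists>\<T>\<subseteq>\<S>. card \<T> \<le> p \<and> \<Union>\<T> = F"
proof -
  from assms have "\<exists>\<S>. \<S> \<subseteq> Pow A \<and> finite \<S> \<and> (\<Sum>S\<in>\<S>. card S) \<le> p * card A \<and>
          (\<forall>F\<in>\<F>. \<exists>\<T>\<subseteq>\<S>. card \<T> \<le> p \<and> \<Union>\<T> = F)"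
    unfolding range_tree_def .
  then show thesis
    by (elim exE conjE) (rule that, assumption+, erule (1) bspec)
qed

lemma range_tree_mono:
  assumes "range_tree A p \<F>" "\<G> \<subseteq> \<F>" "p \<le> q"
  shows "range_tree A q \<G>"
proof -
  obtain \<S> where S: "\<S> \<subseteq> Pow A" "finite \<S>" "(\<Sum>S\<in>\<S>. card S) \<le> p * card A"
      "\<And>F. F \<in> \<F> \<Longrightarrow> \<exists>\<T>\<subseteq>\<S>. card \<T> \<le> p \<and> \<Union>\<T> = F"
    by (rule range_treeE[OF assms(1)]) (rule that)
  have "(\<Sum>S\<in>\<S>. card S) \<le> q * card A"
    using S(3) assms(3) mult_le_mono1 order_trans by blast
  moreover have "\<exists>\<T>\<subseteq>\<S>. card \<T> \<le> q \<and> \<Union>\<T> = F" if "F \<in> \<G>" for F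
    using S(4)[of F] that assms(2,3) by (meson order_trans subsetD)
  ultimately show ?thesis using S(1,2) by (intro range_treeI[of \<S>])
qed

lemma range_tree_subset: "range_tree A p \<F> \<Longrightarrow> \<G> \<subseteq> \<F> \<Longrightarrow> range_tree A p \<G>"
  using range_tree_mono by blast

lemma sum_card_Un_le:
  assumes "finite \<S>" "finite \<S>'"
  shows "(\<Sum>S\<in>\<S>\<union>\<S>'. card S) \<le> (\<Sum>S\<in>\<S>. card S) + (\<Sum>S\<in>\<S>'. card S)"
  using sum.union_inter[OF assms, of card] by linarith

lemma sum_card_UN_le:
  assumes "finite I" "\<And>i. i \<in> I \<Longrightarrow> finite (\<S> i)"
  shows "(\<Sum>S\<in>(\<Union>i\<in>I. \<S> i). card S) \<le> (\<Sum>i\<in>I. \<Sum>S\<in>\<S> i. card S)"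
  using assms
proof (induction I rule: finite_induct)
  case (insert i I)
  have "(\<Sum>S\<in>(\<Union>i\<in>insert i I. \<S> i). card S) = (\<Sum>S\<in>\<S> i \<union> (\<Union>i\<in>I. \<S> i). card S)"
    by simp
  also have "\<dots> \<le> (\<Sum>S\<in>\<S> i. card S) + (\<Sum>S\<in>(\<Union>i\<in>I. \<S> i). card S)"
    using insert by (intro sum_card_Un_le) auto
  also have "\<dots> \<le> (\<Sum>S\<in>\<S> i. card S) + (\<Sum>i\<in>I. \<Sum>S\<in>\<S> i. card S)"
    using insert by auto
  finally show ?case using insert by simp
qed simp

lemma range_tree_Un:
  assumes "range_tree A p \<F>" "range_tree A q \<G>"
    and "\<And>H. H \<in> \<H> \<Longrightarrow> \<exists>F\<in>insert {} \<F>. \<exists>G\<in>insert {} \<G>. H = F \<union> G"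
  shows "range_tree A (p + q) \<H>"
proof -
  obtain \<S> where S: "\<S> \<subseteq> Pow A" "finite \<S>" "(\<Sum>S\<in>\<S>. card S) \<le> p * card A"
      "\<And>F. F \<in> \<F> \<Longrightarrow> \<exists>\<T>\<subseteq>\<S>. card \<T> \<le> p \<and> \<Union>\<T> = F"
    by (rule range_treeE[OF assms(1)]) (rule that)
  obtain \<S>' where S': "\<S>' \<subseteq> Pow A" "finite \<S>'" "(\<Sum>S\<in>\<S>'. card S) \<le> q * card A"
      "\<And>F. F \<in> \<G> \<Longrightarrow> \<exists>\<T>\<subseteq>\<S>'. card \<T> \<le> q \<and> \<Union>\<T> = F"
    by (rule range_treeE[OF assms(2)]) (rule that)
  have 1: "\<exists>\<T>\<subseteq>\<S>. card \<T> \<le> p \<and> \<Union>\<T> = F" if "F \<in> insert {} \<F>" for F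
    using that S(4)[of F] by (elim insertE) (simp add: exI[of _ "{}"], blast)
  have 2: "\<exists>\<T>\<subseteq>\<S>'. card \<T> \<le> q \<and> \<Union>\<T> = F" if "F \<in> insert {} \<G>" for F
    using that S'(4)[of F] by (elim insertE) (simp add: exI[of _ "{}"], blast)
  have "\<exists>\<T>\<subseteq>\<S>\<union>\<S>'. card \<T> \<le> p + q \<and> \<Union>\<T> = H" if H: "H \<in> \<H>" for H
  proof -
    obtain F G where FG: "F \<in> insert {} \<F>" "G \<in> insert {} \<G>" "H = F \<union> G"
      using assms(3)[OF H] by blast
    obtain \<T> \<T>' where "\<T> \<subseteq> \<S>" "card \<T> \<le> p" "\<Union>\<T> = F" "\<T>' \<subseteq> \<S>'" "card \<T>' \<le> q" "\<Union>\<T>' = G"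
      using 1[OF FG(1)] 2[OF FG(2)] by blast
    moreover have "card (\<T> \<union> \<T>') \<le> card \<T> + card \<T>'" by (rule card_Un_le)
    ultimately show ?thesis using FG(3) by (intro exI[of _ "\<T> \<union> \<T>'"]) auto
  qed
  moreover have "(\<Sum>S\<in>\<S>\<union>\<S>'. card S) \<le> (p + q) * card A"
    using sum_card_Un_le[OF S(2) S'(2)] S(3) S'(3) by (simp add: add_mult_distrib)
  ultimately show ?thesis
    using S(1,2) S'(1,2) by (intro range_treeI[of "\<S> \<union> \<S>'"]) auto
qed

text \<open>The factor \<open>N\<close> serves the number of members per set; the total size stays as it is.\<close>
lemma range_tree_Union:
  assumes "range_tree A p \<F>" "N > 0"
    and "\<And>H. H \<in> \<H> \<Longrightarrow> \<exists>\<F>'\<subseteq>\<F>. finite \<F>' \<and> card \<F>' \<le> N \<and> H = \<Union>\<F>'"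
  shows "range_tree A (N * p) \<H>"
proof -
  obtain \<S> where S: "\<S> \<subseteq> Pow A" "finite \<S>" "(\<Sum>S\<in>\<S>. card S) \<le> p * card A"
      "\<And>F. F \<in> \<F> \<Longrightarrow> \<exists>\<T>\<subseteq>\<S>. card \<T> \<le> p \<and> \<Union>\<T> = F"
    by (rule range_treeE[OF assms(1)]) (rule that)
  obtain \<T> where T: "\<And>F. F \<in> \<F> \<Longrightarrow> \<T> F \<subseteq> \<S> \<and> card (\<T> F) \<le> p \<and> \<Union>(\<T> F) = F"
    using S(4) by metis
  have "\<exists>\<T>\<subseteq>\<S>. card \<T> \<le> N * p \<and> \<Union>\<T> = H" if H: "H \<in> \<H>" for H
  proof -
    obtain \<F>' where F: "\<F>' \<subseteq> \<F>" "finite \<F>'" "card \<F>' \<le> N" "H = \<Union>\<F>'"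
      using assms(3)[OF H] by blast
    have "card (\<Union>F\<in>\<F>'. \<T> F) \<le> (\<Sum>F\<in>\<F>'. card (\<T> F))"
      using F(2) by (rule card_UN_le)
    also have "\<dots> \<le> card \<F>' * p"
      using T F(1) by (metis (no_types, lifting) of_nat_id subsetD sum_bounded_above)
    also have "\<dots> \<le> N * p" using F(3) by simp
    finally have "card (\<Union>F\<in>\<F>'. \<T> F) \<le> N * p" .
    moreover have "(\<Union>F\<in>\<F>'. \<T> F) \<subseteq> \<S>"
      using T F(1) by (intro UN_least) auto
    moreover have "\<Union>(\<Union>F\<in>\<F>'. \<T> F) = H"
    proof -
      have "\<Union>(\<Union>F\<in>\<F>'. \<T> F) = (\<Union>F\<in>\<F>'. \<Union>(\<T> F))" by blast
      also have "\<dots> = (\<Union>F\<in>\<F>'. F)" using T F(1) by (intro SUP_cong) auto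
      finally show ?thesis using F(4) by simp
    qed
    ultimately show ?thesis by (intro exI[of _ "\<Union>F\<in>\<F>'. \<T> F"] conjI)
  qed
  moreover have "(\<Sum>S\<in>\<S>. card S) \<le> N * p * card A"
  proof -
    have "p * card A \<le> N * p * card A" using assms(2) by simp
    thus ?thesis using S(3) by linarith
  qed
  ultimately show ?thesis using S(1,2) by (intro range_treeI[of \<S>])
qed

text \<open>
  Grow a second tree on every member of the first one. Since the members have total size
  \<open>p * card A\<close>, the sizes multiply, and so do the numbers of members per set. The sets that the
  second tree has to serve may be simpler than those of \<open>\<H>\<close>, because only members \<open>S\<close> inside the set
  \<open>F\<close> occur: this is where a case distinction along \<open>F\<close> simplifies \<open>H\<close>.
\<close>
lemma range_tree_compose:
  assumes "range_tree A p \<F>" "\<And>S. S \<subseteq> A \<Longrightarrow> range_tree S q (\<G> S)"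
    and "\<And>H. H \<in> \<H> \<Longrightarrow> \<exists>F\<in>\<F>. H \<subseteq> F \<and> (\<forall>S\<subseteq>F. H \<inter> S \<in> \<G> S)"
  shows "range_tree A (p * q) \<H>"
proof -
  obtain \<S> where S: "\<S> \<subseteq> Pow A" "finite \<S>" "(\<Sum>S\<in>\<S>. card S) \<le> p * card A"
      "\<And>F. F \<in> \<F> \<Longrightarrow> \<exists>\<T>\<subseteq>\<S>. card \<T> \<le> p \<and> \<Union>\<T> = F"
    by (rule range_treeE[OF assms(1)]) (rule that)
  have "\<exists>\<R>. \<R> \<subseteq> Pow S \<and> finite \<R> \<and> (\<Sum>R\<in>\<R>. card R) \<le> q * card S \<and>
      (\<forall>F\<in>\<G> S. \<exists>\<T>\<subseteq>\<R>. card \<T> \<le> q \<and> \<Union>\<T> = F)" if "S \<in> \<S>" for S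
    using assms(2)[of S] S(1) that unfolding range_tree_def by (meson PowD subsetD)
  then obtain \<R> where R: "\<And>S. S \<in> \<S> \<Longrightarrow> \<R> S \<subseteq> Pow S \<and> finite (\<R> S) \<and> (\<Sum>R\<in>\<R> S. card R) \<le> q * card S \<and>
      (\<forall>F\<in>\<G> S. \<exists>\<T>\<subseteq>\<R> S. card \<T> \<le> q \<and> \<Union>\<T> = F)"
    by metis
  define \<U> where "\<U> = (\<Union>S\<in>\<S>. \<R> S)"
  have "(\<Sum>U\<in>\<U>. card U) \<le> (\<Sum>S\<in>\<S>. \<Sum>R\<in>\<R> S. card R)"
    unfolding \<U>_def using S(2) R by (intro sum_card_UN_le) auto
  also have "\<dots> \<le> (\<Sum>S\<in>\<S>. q * card S)" using R by (intro sum_mono) auto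
  also have "\<dots> \<le> q * (p * card A)" using S(3) by (simp flip: sum_distrib_left)
  finally have 1: "(\<Sum>U\<in>\<U>. card U) \<le> p * q * card A" by (simp add: mult_ac)
  have "\<exists>\<T>\<subseteq>\<U>. card \<T> \<le> p * q \<and> \<Union>\<T> = H" if HH: "H \<in> \<H>" for H
  proof -
    obtain F where F: "F \<in> \<F>" "H \<subseteq> F" "\<And>S. S \<subseteq> F \<Longrightarrow> H \<inter> S \<in> \<G> S" using assms(3)[OF HH] by blast
    obtain \<T> where T: "\<T> \<subseteq> \<S>" "card \<T> \<le> p" "\<Union>\<T> = F" using S(4) F(1) by blast
    have "\<exists>\<V>\<subseteq>\<R> S. card \<V> \<le> q \<and> \<Union>\<V> = H \<inter> S" if "S \<in> \<T>" for S
    proof -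
      have "H \<inter> S \<in> \<G> S" using F(3) T(3) that by blast
      thus ?thesis using R[of S] T(1) that by blast
    qed
    then obtain \<V> where V: "\<And>S. S \<in> \<T> \<Longrightarrow> \<V> S \<subseteq> \<R> S \<and> card (\<V> S) \<le> q \<and> \<Union>(\<V> S) = H \<inter> S"
      by metis
    have finT: "finite \<T>" using T(1) S(2) finite_subset by blast
    have "card (\<Union>S\<in>\<T>. \<V> S) \<le> (\<Sum>S\<in>\<T>. card (\<V> S))"
      using finT by (rule card_UN_le)
    also have "\<dots> \<le> card \<T> * q"
      using V by (metis (no_types, lifting) of_nat_id sum_bounded_above)
    also have "\<dots> \<le> p * q" using T(2) by simp
    finally have "card (\<Union>S\<in>\<T>. \<V> S) \<le> p * q" .
    moreover have "(\<Union>S\<in>\<T>. \<V> S) \<subseteq> \<U>"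
      unfolding \<U>_def using V T(1) by (intro UN_mono) auto
    moreover have "\<Union>(\<Union>S\<in>\<T>. \<V> S) = H"
    proof -
      have "\<Union>(\<Union>S\<in>\<T>. \<V> S) = (\<Union>S\<in>\<T>. \<Union>(\<V> S))" by blast
      also have "\<dots> = (\<Union>S\<in>\<T>. H \<inter> S)" using V by (intro SUP_cong) auto
      also have "\<dots> = H" using F(2) T(3) by blast
      finally show ?thesis .
    qed
    ultimately show ?thesis by (intro exI[of _ "\<Union>S\<in>\<T>. \<V> S"] conjI)
  qed
  moreover have "\<U> \<subseteq> Pow A" "finite \<U>" using R S(1,2) unfolding \<U>_def by (fastforce, auto)
  ultimately show ?thesis using 1 by (intro range_treeI[of \<U>])
qed

lemma range_tree_fixed:
  assumes "finite A" "X \<subseteq> A"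
  shows "range_tree A 1 {{}, X}"
proof (rule range_treeI[of "{X}"])
  fix F assume "F \<in> {{}, X}"
  then consider "F = \<Union>{}" | "F = \<Union>{X}" by auto
  thus "\<exists>\<T>\<subseteq>{X}. card \<T> \<le> 1 \<and> \<Union>\<T> = F"
  proof cases
    case 1
    thus ?thesis by (intro exI[of _ "{}"]) simp
  next
    case 2
    thus ?thesis by (intro exI[of _ "{X}"]) simp
  qed
qed (use assms card_mono in auto)

lemma finite_ex_max:
  fixes h :: "'x \<Rightarrow> 'l::linorder"
  assumes "finite N" "N \<noteq> {}"
  shows "\<exists>s. s \<in> N \<and> (\<forall>x\<in>N. h x \<le> h s)"
proof -
  have "Max (h ` N) \<in> h ` N" using assms by (intro Max_in) auto
  then obtain s where "s \<in> N" "Max (h ` N) = h s" by auto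
  moreover have "h x \<le> Max (h ` N)" if "x \<in> N" for x using that assms by (intro Max_ge) auto
  ultimately show ?thesis by auto
qed

lemma finite_ex_min:
  fixes h :: "'x \<Rightarrow> 'l::linorder"
  assumes "finite N" "N \<noteq> {}"
  shows "\<exists>s. s \<in> N \<and> (\<forall>x\<in>N. h s \<le> h x)"
proof -
  have "Min (h ` N) \<in> h ` N" using assms by (intro Min_in) auto
  then obtain s where "s \<in> N" "Min (h ` N) = h s" by auto
  moreover have "Min (h ` N) \<le> h x" if "x \<in> N" for x using that assms by (intro Min_le) auto
  ultimately show ?thesis by auto
qed

lemma ex_lowest_subset:
  fixes h :: "'x \<Rightarrow> 'l::linorder"
  assumes "finite A" "m \<le> card A"
  shows "\<exists>L\<subseteq>A. card L = m \<and> (\<forall>x\<in>L. \<forall>y\<in>A-L. h x \<le> h y)"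
  using assms(2)
proof (induction m)
  case (Suc m)
  then obtain L where L: "L \<subseteq> A" "card L = m" "\<forall>x\<in>L. \<forall>y\<in>A-L. h x \<le> h y" by auto
  have fin: "finite L" "finite (A - L)" using L(1) assms(1) finite_subset by auto
  have "A - L \<noteq> {}" using L Suc.prems by (metis Diff_eq_empty_iff Suc_n_not_le_n subset_antisym)
  then obtain z where z: "z \<in> A - L" "\<forall>y\<in>A-L. h z \<le> h y"
    using fin(2) by (metis arg_min_if_finite(1) arg_min_least)
  show ?case
  proof (intro exI[of _ "insert z L"] conjI ballI)
    show "card (insert z L) = Suc m" using z L fin by auto
  qed (use z L in auto)
qed (simp add: exI[of _ "{}"])

text \<open>Both the initial and the final segments of the preorder that \<open>h\<close> induces on \<open>A\<close>.\<close>
abbreviation cuts :: "('x \<Rightarrow> 'l::linorder) \<Rightarrow> 'x set \<Rightarrow> 'x set set" where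
  "cuts h A \<equiv> {D. D \<subseteq> A \<and>
     ((\<forall>x\<in>D. \<forall>y\<in>A-D. h x < h y) \<or> (\<forall>x\<in>D. \<forall>y\<in>A-D. h y < h x))}"
text \<open>
  Halve \<open>A\<close> along \<open>h\<close> and recurse: a segment is a segment of one half, possibly together with the
  whole other half. So each level of the recursion costs one more member for a segment and one more
  copy of \<open>A\<close> for the total size.
\<close>
lemma range_tree_cuts:
  fixes h :: "'x \<Rightarrow> 'l::linorder"
  assumes "finite A" "card A \<le> 2 ^ k"
  shows "range_tree A (k + 1) (cuts h A)"
  using assms
proof (induction k arbitrary: A)
  case 0
  have "D \<in> {{}, A}" if "D \<subseteq> A" for D
  proof (cases "D = {}")
    case False
    have "card D > 0" using False that 0 finite_subset by fastforce
    hence "D = A" using 0 card_seteq[OF 0(1) that] by simp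
    thus ?thesis by simp
  qed simp
  hence "cuts h A \<subseteq> {{}, A}" by blast
  thus ?case using range_tree_fixed[OF 0(1), of A] range_tree_subset[of A] by auto
next
  case (Suc k)
  obtain L where L: "L \<subseteq> A" "card L = min (2 ^ k) (card A)" "\<And>x y. x \<in> L \<Longrightarrow> y \<in> A - L \<Longrightarrow> h x \<le> h y"
    using ex_lowest_subset[OF Suc.prems(1), of "min (2 ^ k) (card A)" h] by auto
  define U where "U = A - L"
  have fin: "finite L" "finite U" using L(1) Suc.prems(1) finite_subset unfolding U_def by auto
  have cardU: "card U + card L = card A"
    unfolding U_def using L(1) fin Suc.prems(1) by (metis card_Diff_subset card_mono le_add_diff_inverse2)
  have cU: "card U \<le> 2 ^ k" "card L \<le> 2 ^ k" using cardU L(2) Suc.prems(2) by auto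
  obtain \<S> where S: "\<S> \<subseteq> Pow U" "finite \<S>" "(\<Sum>S\<in>\<S>. card S) \<le> (k + 1) * card U"
      "\<And>F. F \<in> cuts h U \<Longrightarrow> \<exists>\<T>\<subseteq>\<S>. card \<T> \<le> k + 1 \<and> \<Union>\<T> = F"
    by (rule range_treeE[OF Suc.IH[OF fin(2) cU(1)]]) (rule that)
  obtain \<S>' where S': "\<S>' \<subseteq> Pow L" "finite \<S>'" "(\<Sum>S\<in>\<S>'. card S) \<le> (k + 1) * card L"
      "\<And>F. F \<in> cuts h L \<Longrightarrow> \<exists>\<T>\<subseteq>\<S>'. card \<T> \<le> k + 1 \<and> \<Union>\<T> = F"
    by (rule range_treeE[OF Suc.IH[OF fin(1) cU(2)]]) (rule that)
  define \<R> where "\<R> = {L, U} \<union> (\<S> \<union> \<S>')"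
  have "(\<Sum>S\<in>\<R>. card S) \<le> (\<Sum>S\<in>{L,U}. card S) + (\<Sum>S\<in>\<S>\<union>\<S>'. card S)"
    unfolding \<R>_def using S S' by (intro sum_card_Un_le) auto
  also have "\<dots> \<le> (card L + card U) + ((\<Sum>S\<in>\<S>. card S) + (\<Sum>S\<in>\<S>'. card S))"
    using sum_card_Un_le[OF S(2) S'(2)] by (cases "L = U") auto
  also have "\<dots> \<le> (Suc k + 1) * card A" using S(3) S'(3) by (simp add: algebra_simps flip: cardU)
  finally have 1: "(\<Sum>S\<in>\<R>. card S) \<le> (Suc k + 1) * card A" .
  have half: "\<exists>\<T>\<subseteq>\<R>. card \<T> \<le> Suc k + 1 \<and> \<Union>\<T> = D"
    if "\<T> \<subseteq> \<S> \<union> \<S>'" "card \<T> \<le> k + 1" and D: "D = \<Union>\<T> \<or> D = L \<union> \<Union>\<T> \<or> D = U \<union> \<Union>\<T>" for \<T> D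
  proof -
    obtain X where X: "X \<in> {L, U}" "D = \<Union>\<T> \<or> D = X \<union> \<Union>\<T>" using D by blast
    have "finite \<T>" using that(1) S(2) S'(2) finite_subset by blast
    hence "card (insert X \<T>) \<le> Suc k + 1" using that(2) by (simp add: card_insert_if)
    moreover have "insert X \<T> \<subseteq> \<R>" "\<T> \<subseteq> \<R>" using X(1) that(1) unfolding \<R>_def by auto
    ultimately show ?thesis
    proof (use X(2) in \<open>elim disjE\<close>)
      assume "D = \<Union>\<T>"
      thus ?thesis using \<open>\<T> \<subseteq> \<R>\<close> that(2) by (intro exI[of _ \<T>]) simp
    next
      assume "D = X \<union> \<Union>\<T>"
      thus ?thesis using \<open>insert X \<T> \<subseteq> \<R>\<close> \<open>card (insert X \<T>) \<le> Suc k + 1\<close>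
        by (intro exI[of _ "insert X \<T>"]) simp
    qed
  qed
  have "\<exists>\<T>\<subseteq>\<R>. card \<T> \<le> Suc k + 1 \<and> \<Union>\<T> = D" if D: "D \<in> cuts h A" for D
  proof -
    have "D \<inter> L \<in> cuts h L" "D \<inter> U \<in> cuts h U" using D L(1) unfolding U_def by blast+
    then obtain \<T> \<T>' where T: "\<T> \<subseteq> \<S>" "card \<T> \<le> k + 1" "\<Union>\<T> = D \<inter> U"
        and T': "\<T>' \<subseteq> \<S>'" "card \<T>' \<le> k + 1" "\<Union>\<T>' = D \<inter> L"
      using S(4)[of "D \<inter> U"] S'(4)[of "D \<inter> L"] by meson
    have D': "D = (D \<inter> L) \<union> (D \<inter> U)" using D L(1) unfolding U_def by blast
    consider "D \<inter> U = {}" | "L \<subseteq> D" | "D \<inter> L = {}" | "U \<subseteq> D"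
    proof -
      have "L \<subseteq> D \<or> D \<inter> U = {}" if cut: "\<forall>x\<in>D. \<forall>y\<in>A-D. h x < h y"
      proof (rule disjCI, rule subsetI, rule ccontr)
        fix y assume "D \<inter> U \<noteq> {}" "y \<in> L" "y \<notin> D"
        then obtain x where "x \<in> D" "x \<in> U" by blast
        with \<open>y \<in> L\<close> \<open>y \<notin> D\<close> have "h x < h y" "h y \<le> h x"
          using cut L(1) L(3)[of y x] unfolding U_def by auto
        thus False by simp
      qed
      moreover have "U \<subseteq> D \<or> D \<inter> L = {}" if cut: "\<forall>x\<in>D. \<forall>y\<in>A-D. h y < h x"
      proof (rule disjCI, rule subsetI, rule ccontr)
        fix y assume "D \<inter> L \<noteq> {}" "y \<in> U" "y \<notin> D"
        then obtain x where "x \<in> D" "x \<in> L" by blast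
        with \<open>y \<in> U\<close> \<open>y \<notin> D\<close> have "h y < h x" "h x \<le> h y"
          using cut L(1) L(3)[of x y] unfolding U_def by auto
        thus False by simp
      qed
      ultimately show ?thesis using D that by blast
    qed
    thus ?thesis
    proof cases
      case 1
      show ?thesis by (rule half[of \<T>' D]) (use 1 T' D' in auto)
    next
      case 2
      show ?thesis by (rule half[of \<T> D]) (use 2 T D' in auto)
    next
      case 3
      show ?thesis by (rule half[of \<T> D]) (use 3 T D' in auto)
    next
      case 4
      show ?thesis by (rule half[of \<T>' D]) (use 4 T' D' in auto)
    qed
  qed
  moreover have "\<R> \<subseteq> Pow A" "finite \<R>"
    using S(1,2) S'(1,2) L(1) unfolding \<R>_def U_def by (blast, simp)
  ultimately show ?case using 1 by (intro range_treeI[of \<R>])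
qed

text \<open>By composition: a second condition only has to be resolved inside the members for the first.\<close>
lemma range_tree_Inter:
  assumes "finite J"
    and "\<And>j S. j \<in> J \<Longrightarrow> S \<subseteq> A \<Longrightarrow> range_tree S p {{x\<in>S. Q x} |Q. Q \<in> \<Q> j}"
    and "finite A"
  shows "range_tree A (p ^ card J) {{x\<in>A. \<forall>j\<in>J. q j x} |q. \<forall>j\<in>J. q j \<in> \<Q> j}"
proof -
  have "\<forall>A'\<subseteq>A. range_tree A' (p ^ card J) {{x\<in>A'. \<forall>j\<in>J. q j x} |q. \<forall>j\<in>J. q j \<in> \<Q> j}"
    using assms(1,2)
  proof (induction J rule: finite_induct)
    case empty
    have "range_tree A' 1 {A'}" if "A' \<subseteq> A" for A'
      using range_tree_subset[OF range_tree_fixed[of A' A']] that assms(3) finite_subset by blast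
    thus ?case by simp
  next
    case (insert j J)
    show ?case
    proof (intro allI impI)
      fix A' assume A': "A' \<subseteq> A"
      have "range_tree A' (p * p ^ card J) {{x\<in>A'. \<forall>j\<in>insert j J. q j x} |q. \<forall>j\<in>insert j J. q j \<in> \<Q> j}"
      proof (rule range_tree_compose)
        show "range_tree A' p {{x\<in>A'. Q x} |Q. Q \<in> \<Q> j}" using insert.prems A' by blast
        show "range_tree S (p ^ card J) {{x\<in>S. \<forall>j\<in>J. q j x} |q. \<forall>j\<in>J. q j \<in> \<Q> j}" if "S \<subseteq> A'" for S
          using insert.IH insert.prems A' that by (metis (no_types, lifting) insertCI order_trans)
        fix H assume "H \<in> {{x\<in>A'. \<forall>j\<in>insert j J. q j x} |q. \<forall>j\<in>insert j J. q j \<in> \<Q> j}"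
        then obtain q where q: "H = {x\<in>A'. \<forall>j\<in>insert j J. q j x}" "\<forall>j\<in>insert j J. q j \<in> \<Q> j" by blast
        have "H \<inter> S = {x\<in>S. \<forall>j\<in>J. q j x}" if "S \<subseteq> {x\<in>A'. q j x}" for S
          using that q(1) by auto
        thus "\<exists>F\<in>{{x\<in>A'. Q x} |Q. Q \<in> \<Q> j}. H \<subseteq> F \<and>
            (\<forall>S\<subseteq>F. H \<inter> S \<in> {{x\<in>S. \<forall>j\<in>J. q j x} |q. \<forall>j\<in>J. q j \<in> \<Q> j})"
          using q by (intro bexI[of _ "{x\<in>A'. q j x}"]) auto
      qed
      thus "range_tree A' (p ^ card (insert j J)) {{x\<in>A'. \<forall>j\<in>insert j J. q j x} |q. \<forall>j\<in>insert j J. q j \<in> \<Q> j}"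
        using insert.hyps by simp
    qed
  qed
  thus ?thesis by blast
qed

section \<open>From range trees for the fibres to a bound on the relation\<close>

text \<open>
  The bound \<open>m\<close> on \<open>A\<close> is a separate parameter, so that \<open>p\<close> may be polylogarithmic in it; quantifying
  over all such \<open>A\<close>, and not only over the vertex sets of one relation, keeps the property under
  slicing.
\<close>
definition range_tree_fibres ::
  "nat \<Rightarrow> (nat \<Rightarrow> 'b set) \<Rightarrow> ((nat \<Rightarrow> 'b) \<Rightarrow> bool) \<Rightarrow> nat \<Rightarrow> nat \<Rightarrow> bool" where
  "range_tree_fibres r X P m p \<longleftrightarrow> (\<forall>j<r. \<forall>A\<subseteq>X j. finite A \<longrightarrow> card A \<le> m \<longrightarrow>
     range_tree A p {{z\<in>A. P (y(j := z))} |y. y \<in> (\<Pi>\<^sub>E i\<in>{..<r}. X i)})"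

text \<open>A fibre of the intersection of slices is the intersection of \<open>card Z\<close> fibres.\<close>
lemma range_tree_fibres_slice:
  assumes P: "range_tree_fibres (Suc r) X P m p" and Z: "finite Z" "Z \<subseteq> X r"
  shows "range_tree_fibres r X (\<lambda>w. \<forall>s\<in>Z. P (w(r := s))) m (p ^ card Z)"
  unfolding range_tree_fibres_def
proof (intro allI impI)
  fix j A assume j: "j < r" and A: "A \<subseteq> X j" "finite A" "card A \<le> m"
  define \<Q> where "\<Q> = {(\<lambda>z. P (y(j := z))) |y. y \<in> (\<Pi>\<^sub>E i\<in>{..<Suc r}. X i)}"
  have "range_tree S p {{z\<in>S. Q z} |Q. Q \<in> \<Q>}" if "S \<subseteq> A" for S
  proof -
    have "range_tree S p {{z\<in>S. P (y(j := z))} |y. y \<in> (\<Pi>\<^sub>E i\<in>{..<Suc r}. X i)}"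
      using P j A that finite_subset[OF that A(2)] card_mono[OF A(2) that]
      unfolding range_tree_fibres_def by auto
    moreover have "{{z\<in>S. Q z} |Q. Q \<in> \<Q>} = {{z\<in>S. P (y(j := z))} |y. y \<in> (\<Pi>\<^sub>E i\<in>{..<Suc r}. X i)}"
      unfolding \<Q>_def by auto
    ultimately show ?thesis by simp
  qed
  hence "range_tree A (p ^ card Z) {{z\<in>A. \<forall>s\<in>Z. q s z} |q. \<forall>s\<in>Z. q s \<in> \<Q>}"
    using range_tree_Inter[OF Z(1), of A p "\<lambda>_. \<Q>"] A(2) by simp
  moreover have "{z\<in>A. \<forall>s\<in>Z. P ((y(j := z))(r := s))} \<in> {{z\<in>A. \<forall>s\<in>Z. q s z} |q. \<forall>s\<in>Z. q s \<in> \<Q>}"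
    if y: "y \<in> (\<Pi>\<^sub>E i\<in>{..<r}. X i)" for y
  proof (intro CollectI exI conjI ballI)
    show "{z\<in>A. \<forall>s\<in>Z. P ((y(j := z))(r := s))} = {z\<in>A. \<forall>s\<in>Z. (\<lambda>s z. P ((y(r := s))(j := z))) s z}"
      using j by (simp add: fun_upd_twist)
    fix s assume s: "s \<in> Z"
    have "y(r := s) \<in> (\<Pi>\<^sub>E i\<in>{..<Suc r}. X i)"
      using y s Z(2) by (auto simp: lessThan_Suc PiE_def extensional_def Pi_def)
    thus "(\<lambda>z. P ((y(r := s))(j := z))) \<in> \<Q>" unfolding \<Q>_def by blast
  qed
  ultimately show "range_tree A (p ^ card Z)
      {{z\<in>A. \<forall>s\<in>Z. P ((y(j := z))(r := s))} |y. y \<in> (\<Pi>\<^sub>E i\<in>{..<r}. X i)}"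
    by (elim range_tree_subset) (auto simp only: subset_iff mem_Collect_eq)
qed

text \<open>A forbidden box in the intersection of the slices, times \<open>Z\<close>, is a forbidden box one dimension up.\<close>
lemma K_free_slice:
  assumes free: "K_free (Suc r) t B {x \<in> (\<Pi>\<^sub>E j\<in>{..<Suc r}. B j). P x}"
    and Z: "Z \<subseteq> B r" "card Z = t"
  shows "K_free r t B {w \<in> (\<Pi>\<^sub>E j\<in>{..<r}. B j). \<forall>s\<in>Z. P (w(r := s))}"
  unfolding K_free_def
proof
  assume "\<exists>T. (\<forall>j<r. T j \<subseteq> B j \<and> card (T j) = t) \<and>
    (\<Pi>\<^sub>E j\<in>{..<r}. T j) \<subseteq> {w \<in> (\<Pi>\<^sub>E j\<in>{..<r}. B j). \<forall>s\<in>Z. P (w(r := s))}"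
  then obtain T where TB: "\<forall>j<r. T j \<subseteq> B j \<and> card (T j) = t"
    and TP: "(\<Pi>\<^sub>E j\<in>{..<r}. T j) \<subseteq> {w \<in> (\<Pi>\<^sub>E j\<in>{..<r}. B j). \<forall>s\<in>Z. P (w(r := s))}"
    by (elim exE conjE) (rule that)
  have T': "\<forall>j<Suc r. (T(r := Z)) j \<subseteq> B j \<and> card ((T(r := Z)) j) = t"
    using TB Z by (auto simp: less_Suc_eq)
  have "x \<in> {x \<in> (\<Pi>\<^sub>E j\<in>{..<Suc r}. B j). P x}" if x: "x \<in> (\<Pi>\<^sub>E j\<in>{..<Suc r}. (T(r := Z)) j)" for x
  proof -
    have "x j \<in> (T(r := Z)) j" if "j < Suc r" for j using x that by blast
    hence xT: "\<And>j. j < r \<Longrightarrow> x j \<in> T j" and xZ: "x r \<in> Z"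
      by (metis fun_upd_other less_Suc_eq less_irrefl, metis fun_upd_same lessI)
    have "restrict x {..<r} \<in> (\<Pi>\<^sub>E j\<in>{..<r}. T j)" using xT by auto
    moreover have "(restrict x {..<r})(r := x r) = x"
      using x by (auto simp: fun_eq_iff PiE_def extensional_def)
    ultimately have "P ((restrict x {..<r})(r := x r))" "(restrict x {..<r})(r := x r) = x"
      using TP xZ by blast+
    hence "P x" by simp
    moreover have "x \<in> (\<Pi>\<^sub>E j\<in>{..<Suc r}. B j)" 
      using x PiE_mono[of "{..<Suc r}" "T(r := Z)" B] T' by blast
    ultimately show ?thesis by blast
  qed
  hence "(\<Pi>\<^sub>E j\<in>{..<Suc r}. (T(r := Z)) j) \<subseteq> {x \<in> (\<Pi>\<^sub>E j\<in>{..<Suc r}. B j). P x}" by blast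
  with T' free show False unfolding K_free_def by blast
qed

text \<open>Double counting, by splitting off the coordinate \<open>r\<close>.\<close>
lemma sum_card_fibres:
  assumes "\<And>j. j < Suc r \<Longrightarrow> finite (B j)"
  shows "card {x \<in> (\<Pi>\<^sub>E j\<in>{..<Suc r}. B j). P x} =
    (\<Sum>w\<in>(\<Pi>\<^sub>E j\<in>{..<r}. B j). card {z\<in>B r. P (w(r := z))})"
proof -
  let ?W = "\<Pi>\<^sub>E j\<in>{..<r}. B j"
  have "bij_betw (\<lambda>(w, z). w(r := z)) (SIGMA w:?W. {z\<in>B r. P (w(r := z))})
      {x \<in> (\<Pi>\<^sub>E j\<in>{..<Suc r}. B j). P x}"
  proof (rule bij_betwI[where g = "\<lambda>x. (restrict x {..<r}, x r)"])
    show "(\<lambda>(w, z). w(r := z)) \<in> (SIGMA w:?W. {z\<in>B r. P (w(r := z))}) \<rightarrow>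
        {x \<in> (\<Pi>\<^sub>E j\<in>{..<Suc r}. B j). P x}"
      by (auto simp: lessThan_Suc PiE_def extensional_def Pi_def)
    have upd: "(restrict x {..<r})(r := x r) = x" if "x \<in> (\<Pi>\<^sub>E j\<in>{..<Suc r}. B j)" for x
      using that by (auto simp: fun_eq_iff PiE_def extensional_def)
    show "(\<lambda>x. (restrict x {..<r}, x r)) \<in> {x \<in> (\<Pi>\<^sub>E j\<in>{..<Suc r}. B j). P x} \<rightarrow>
        (SIGMA w:?W. {z\<in>B r. P (w(r := z))})"
      using upd by (auto simp: PiE_iff)
    show "(\<lambda>(w, z). w(r := z)) (restrict x {..<r}, x r) = x"
      if "x \<in> {x \<in> (\<Pi>\<^sub>E j\<in>{..<Suc r}. B j). P x}" for x using upd that by simp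
    show "(restrict ((\<lambda>(w, z). w(r := z)) wz) {..<r}, ((\<lambda>(w, z). w(r := z)) wz) r) = wz"
      if "wz \<in> (SIGMA w:?W. {z\<in>B r. P (w(r := z))})" for wz
      using that by (auto simp: fun_eq_iff PiE_def extensional_def restrict_def)
  qed
  hence "card {x \<in> (\<Pi>\<^sub>E j\<in>{..<Suc r}. B j). P x} = card (SIGMA w:?W. {z\<in>B r. P (w(r := z))})"
    by (simp add: bij_betw_same_card)
  also have "\<dots> = (\<Sum>w\<in>?W. card {z\<in>B r. P (w(r := z))})"
    using assms by (intro card_SigmaI finite_PiE) auto
  finally show ?thesis .
qed

text \<open>
  The intersection of \<open>t\<close> slices raises \<open>p\<close> to the power \<open>t\<close>, and one more factor \<open>p\<close> is the weight
  of the range tree of the last vertex set.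
\<close>
primrec polylog_exponent :: "nat \<Rightarrow> nat \<Rightarrow> nat" where
  "polylog_exponent t 0 = 0"
| "polylog_exponent t (Suc r) = t * polylog_exponent t r + 1"

text \<open>
  The factor \<open>n\<close> on the left avoids the exponent \<open>r - 1\<close> and lets the induction start at \<open>r = 0\<close>, where
  freeness means that the only tuple, the empty one, is no edge.
\<close>
lemma card_K_free_le:
  fixes P :: "(nat \<Rightarrow> 'b) \<Rightarrow> bool"
  assumes "p \<ge> 1" and "n \<le> m"
    and "\<And>j. j < r \<Longrightarrow> finite (B j) \<and> B j \<subseteq> X j \<and> card (B j) \<le> n"
    and "range_tree_fibres r X P m p"
    and "K_free r t B {x \<in> (\<Pi>\<^sub>E j\<in>{..<r}. B j). P x}"
  shows "n * card {x \<in> (\<Pi>\<^sub>E j\<in>{..<r}. B j). P x} \<le> r * t * p ^ polylog_exponent t r * n ^ r"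
  using assms
proof (induction r arbitrary: P p)
  case 0
  hence "{x \<in> (\<Pi>\<^sub>E j\<in>{..<0}. B j). P x} = {}" by (auto simp: K_free_def)
  thus ?case by (metis card.empty mult_0_right zero_le)
next
  case (Suc r)
  note p = Suc.prems(1) and nm = Suc.prems(2) and B = Suc.prems(3) and fib = Suc.prems(4)
    and free = Suc.prems(5)
  let ?c = "polylog_exponent t r" and ?C = "r * t"
  define W where "W = (\<Pi>\<^sub>E j\<in>{..<r}. B j)"
  define fibre where "fibre = (\<lambda>w. {z\<in>B r. P (w(r := z))})"
  have finW: "finite W" unfolding W_def using B by (intro finite_PiE) auto
  have cardW: "card W \<le> n ^ r"
  proof -
    have "(\<Prod>j<r. card (B j)) \<le> (\<Prod>j<r. n)" using B by (intro prod_mono) auto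
    thus ?thesis unfolding W_def by (simp add: card_PiE)
  qed
  have Br: "finite (B r)" "B r \<subseteq> X r" "card (B r) \<le> n" using B[of r] by auto
  have "range_tree (B r) p (fibre ` W)"
  proof -
    define \<F> where "\<F> = {{z\<in>B r. P (y(r := z))} |y. y \<in> (\<Pi>\<^sub>E i\<in>{..<Suc r}. X i)}"
    have 1: "range_tree (B r) p \<F>"
      using fib Br nm unfolding range_tree_fibres_def \<F>_def by auto
    have 2: "range_tree (B r) p {{}}"
      by (rule range_treeI[of "{}"]) auto
    have 3: "fibre ` W \<subseteq> \<F>" if nonempty: "B r \<noteq> {}"
    proof
      fix F assume "F \<in> fibre ` W"
      then obtain w where w: "w \<in> W" "F = fibre w" by blast
      obtain z where z: "z \<in> B r" using nonempty by blast
      have "w(r := z) \<in> (\<Pi>\<^sub>E i\<in>{..<Suc r}. X i)"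
      proof (rule PiE_I)
        fix i assume "i \<in> {..<Suc r}"
        thus "(w(r := z)) i \<in> X i" using w(1) z B[of i] unfolding W_def by (cases "i = r") auto
      next
        fix i assume "i \<notin> {..<Suc r}"
        thus "(w(r := z)) i = undefined" using w(1) unfolding W_def by (auto simp: PiE_def extensional_def)
      qed
      moreover have "F = {z'\<in>B r. P ((w(r := z))(r := z'))}" using w(2) unfolding fibre_def by simp
      ultimately show "F \<in> \<F>" unfolding \<F>_def by blast
    qed
    have 4: "fibre ` W \<subseteq> {{}}" if "B r = {}" using that unfolding fibre_def by auto
    show ?thesis
      using range_tree_subset[OF 1 3] range_tree_subset[OF 2 4] by (cases "B r = {}") simp_all
  qed
  then obtain \<S> where S: "\<S> \<subseteq> Pow (B r)" "finite \<S>" "(\<Sum>S\<in>\<S>. card S) \<le> p * card (B r)"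
      "\<And>F. F \<in> fibre ` W \<Longrightarrow> \<exists>\<T>\<subseteq>\<S>. card \<T> \<le> p \<and> \<Union>\<T> = F"
    by (rule range_treeE) (rule that)
  have "\<forall>w\<in>W. \<exists>\<T>\<subseteq>\<S>. card \<T> \<le> p \<and> \<Union>\<T> = fibre w" using S(4) by simp
  then obtain \<T> where T: "\<And>w. w \<in> W \<Longrightarrow> \<T> w \<subseteq> \<S>" "\<And>w. w \<in> W \<Longrightarrow> card (\<T> w) \<le> p"
      "\<And>w. w \<in> W \<Longrightarrow> \<Union>(\<T> w) = fibre w"
    by metis
  (* Members with fewer than t points are paid for by the tuples that use them, the others by their
     own points. *)
  define big where "big = {S\<in>\<S>. card S \<ge> t}"
  have finbig: "finite big" unfolding big_def using S(2) by simp
  have users: "n * card {w\<in>W. S \<in> \<T> w} \<le> ?C * (p ^ t) ^ ?c * n ^ r" if Sbig: "S \<in> big" for S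
  proof -
    obtain Z where Z: "Z \<subseteq> S" "card Z = t" "finite Z"
      using obtain_subset_with_card_n[of t S] Sbig unfolding big_def by auto
    have ZB: "Z \<subseteq> B r" using Z(1) that S(1) unfolding big_def by blast
    let ?E = "{w \<in> (\<Pi>\<^sub>E j\<in>{..<r}. B j). \<forall>s\<in>Z. P (w(r := s))}"
    have "{w\<in>W. S \<in> \<T> w} \<subseteq> ?E"
    proof
      fix w assume w: "w \<in> {w\<in>W. S \<in> \<T> w}"
      hence "Z \<subseteq> fibre w" using T(3)[of w] Z(1) by blast
      thus "w \<in> ?E" using w unfolding fibre_def W_def by blast
    qed
    hence "card {w\<in>W. S \<in> \<T> w} \<le> card ?E"
      using finW unfolding W_def by (intro card_mono) auto
    moreover have "n * card ?E \<le> ?C * (p ^ t) ^ ?c * n ^ r"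
    proof (rule Suc.IH)
      show "1 \<le> p ^ t" using p by simp
      show "range_tree_fibres r X (\<lambda>w. \<forall>s\<in>Z. P (w(r := s))) m (p ^ t)"
        using range_tree_fibres_slice[OF fib Z(3) order_trans[OF ZB Br(2)]] Z(2)
        by (simp del: fun_upd_apply)
      show "K_free r t B ?E" by (rule K_free_slice[OF free ZB Z(2)])
    qed (use nm B in auto)
    ultimately show ?thesis by (meson mult_le_mono2 order_trans)
  qed
  have "card {x \<in> (\<Pi>\<^sub>E j\<in>{..<Suc r}. B j). P x} = (\<Sum>w\<in>W. card (fibre w))"
    unfolding W_def fibre_def using B by (intro sum_card_fibres) auto
  also have "\<dots> \<le> (\<Sum>w\<in>W. p * t + (\<Sum>S\<in>{S\<in>big. S \<in> \<T> w}. card S))"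
  proof (rule sum_mono)
    fix w assume w: "w \<in> W"
    have finT: "finite (\<T> w)" using T(1)[OF w] S(2) finite_subset by blast
    have "card (fibre w) \<le> (\<Sum>S\<in>\<T> w. card S)"
      using card_UN_le[OF finT, of id] T(3)[OF w] by simp
    also have "\<dots> = (\<Sum>S\<in>{S\<in>\<T> w. card S < t}. card S) + (\<Sum>S\<in>{S\<in>\<T> w. \<not> card S < t}. card S)"
      using finT by (subst sum.union_disjoint[symmetric]) (auto intro!: sum.cong)
    also have "(\<Sum>S\<in>{S\<in>\<T> w. card S < t}. card S) \<le> card {S\<in>\<T> w. card S < t} * t"
      using sum_bounded_above[of "{S\<in>\<T> w. card S < t}" card t] by auto
    also have "\<dots> \<le> p * t"
      using card_mono[OF finT, of "{S\<in>\<T> w. card S < t}"] T(2)[OF w] by (intro mult_le_mono1) auto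
    also have "{S\<in>\<T> w. \<not> card S < t} = {S\<in>big. S \<in> \<T> w}" using T(1)[OF w] unfolding big_def by auto
    finally show "card (fibre w) \<le> p * t + (\<Sum>S\<in>{S\<in>big. S \<in> \<T> w}. card S)" by simp
  qed
  also have "\<dots> = card W * (p * t) + (\<Sum>w\<in>W. \<Sum>S\<in>{S\<in>big. S \<in> \<T> w}. card S)"
    by (simp add: sum.distrib)
  also have "(\<Sum>w\<in>W. \<Sum>S\<in>{S\<in>big. S \<in> \<T> w}. card S) = (\<Sum>S\<in>big. \<Sum>w\<in>{w\<in>W. S \<in> \<T> w}. card S)"
    by (rule sum.swap_restrict[OF finW finbig])
  also have "\<dots> = (\<Sum>S\<in>big. card S * card {w\<in>W. S \<in> \<T> w})" by (simp add: mult.commute)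
  finally have "n * card {x \<in> (\<Pi>\<^sub>E j\<in>{..<Suc r}. B j). P x} \<le>
      n * (card W * (p * t) + (\<Sum>S\<in>big. card S * card {w\<in>W. S \<in> \<T> w}))"
    by (rule mult_le_mono2)
  also have "\<dots> = n * card W * (p * t) + (\<Sum>S\<in>big. card S * (n * card {w\<in>W. S \<in> \<T> w}))"
    by (simp add: algebra_simps sum_distrib_left)
  also have "\<dots> \<le> n * n ^ r * (p * t) + (\<Sum>S\<in>big. card S * (?C * (p ^ t) ^ ?c * n ^ r))"
    by (intro add_mono mult_le_mono1 mult_le_mono2 sum_mono users cardW)
  also have "(\<Sum>S\<in>big. card S * (?C * (p ^ t) ^ ?c * n ^ r)) = (\<Sum>S\<in>big. card S) * (?C * (p ^ t) ^ ?c * n ^ r)"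
    by (simp only: sum_distrib_right)
  also have "\<dots> \<le> (p * n) * (?C * (p ^ t) ^ ?c * n ^ r)"
  proof (rule mult_le_mono1)
    have "(\<Sum>S\<in>big. card S) \<le> (\<Sum>S\<in>\<S>. card S)" unfolding big_def using S(2) by (intro sum_mono2) auto
    also have "\<dots> \<le> p * n" using S(3) Br(3) by (meson mult_le_mono2 order_trans)
    finally show "(\<Sum>S\<in>big. card S) \<le> p * n" .
  qed
  also have "n * n ^ r * (p * t) + p * n * (?C * (p ^ t) ^ ?c * n ^ r) =
      (t * p + ?C * p ^ (t * ?c + 1)) * n ^ Suc r"
    by (simp add: algebra_simps power_mult)
  also have "\<dots> \<le> (t + ?C) * p ^ (t * ?c + 1) * n ^ Suc r"
  proof (rule mult_le_mono1)
    have "p \<le> p ^ (t * ?c + 1)" using p by (metis power_increasing power_one_right le_add2)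
    thus "t * p + ?C * p ^ (t * ?c + 1) \<le> (t + ?C) * p ^ (t * ?c + 1)" by (simp add: add_mult_distrib)
  qed
  finally show ?case by (simp add: algebra_simps)
qed

section \<open>Convex orders on finite ultrametric spaces\<close>

text \<open>Distances are measured additively: a large value of \<open>v (x - y)\<close> means that \<open>x\<close> and \<open>y\<close> are close.\<close>
locale valued =
  fixes v :: "'a::field_char_0 \<Rightarrow> ereal"
  assumes valuation: "valuation v"
begin

lemma v_eq_infinity_iff [simp]: "v x = \<infinity> \<longleftrightarrow> x = 0"
  and v_not_MInfty [simp]: "v x \<noteq> -\<infinity>"
  and v_mult: "v (x * y) = v x + v y"
  and v_add_ge: "min (v x) (v y) \<le> v (x + y)"
  using valuation unfolding valuation_def by blast+

lemma v_0 [simp]: "v 0 = \<infinity>" by simp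

lemma v_cases:
  obtains (zero) "x = 0" | (real) w where "x \<noteq> 0" "v x = ereal w"
  using v_not_MInfty[of x] v_eq_infinity_iff[of x] by (cases "v x"; cases "x = 0") auto

lemma v_1 [simp]: "v 1 = 0"
proof -
  obtain w where "v 1 = ereal w" using v_cases[of 1] by auto
  thus ?thesis using v_mult[of 1 1] by simp
qed

lemma v_minus_1: "v (-1) = 0"
proof -
  obtain w where "v (-1) = ereal w" using v_cases[of "-1"] by auto
  thus ?thesis using v_mult[of "-1" "-1"] by simp
qed

lemma v_uminus [simp]: "v (- x) = v x"
  using v_mult[of "-1" x] v_minus_1 by simp

lemma v_minus_commute: "v (x - y) = v (y - x)"
  using v_uminus[of "x - y"] by simp

lemma v_ultra: "min (v (x - y)) (v (y - z)) \<le> v (x - z)"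
  using v_add_ge[of "x - y" "y - z"] by simp

text \<open>
  Seen from \<open>a\<close>, a point \<open>x\<close> and a point \<open>y\<close> at least as close: the distance from \<open>x\<close> to \<open>a\<close> is the
  larger of the distances via \<open>y\<close>, even when these two are equal. Everything below rests on this form
  of the isosceles triangle law.
\<close>
lemma v_nearest:
  assumes "v (x - a) \<le> v (y - a)"
  shows "v (x - a) = min (v (x - y)) (v (y - a))"
proof (rule antisym)
  have "v (x - a) \<le> v (x - y)"
    using v_ultra[of x a y] assms by (simp add: v_minus_commute[of a y] min_def)
  thus "v (x - a) \<le> min (v (x - y)) (v (y - a))" using assms by simp
qed (rule v_ultra)

text \<open>
  The inequality says that every ball meets \<open>A\<close> in an interval. Positions are real numbers, so that there is
  always room for a new point between two old ones.
\<close>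
definition convex_order :: "('x \<Rightarrow> 'a) \<Rightarrow> ('x \<Rightarrow> real) \<Rightarrow> 'x set \<Rightarrow> bool" where
  "convex_order f pos A \<longleftrightarrow> inj_on pos A \<and>
     (\<forall>x\<in>A. \<forall>y\<in>A. \<forall>z\<in>A. pos x < pos y \<and> pos y < pos z \<longrightarrow>
        v (f x - f z) \<le> min (v (f x - f y)) (v (f y - f z)))"

text \<open>
  The place of a new point \<open>a\<close> is immediately behind the last point \<open>x0\<close> among those nearest to \<open>a\<close>.
  Away from \<open>a\<close> on either side the distances to \<open>a\<close> can only grow, because the distance of a point
  to \<open>a\<close> is the larger of its distance to \<open>x0\<close> and the distance from \<open>x0\<close> to \<open>a\<close>. The last clause is convexity around \<open>a\<close>.
\<close>
lemma convex_order_place: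
  assumes "finite A" "convex_order f pos A"
  shows "\<exists>q. q \<notin> pos ` A \<and>
    (\<forall>x\<in>A. \<forall>y\<in>A. pos x < pos y \<and> pos y < q \<longrightarrow> v (f x - a) \<le> v (f y - a)) \<and>
    (\<forall>x\<in>A. \<forall>y\<in>A. q < pos y \<and> pos y < pos x \<longrightarrow> v (f x - a) \<le> v (f y - a)) \<and>
    (\<forall>x\<in>A. \<forall>z\<in>A. pos x < q \<and> q < pos z \<longrightarrow> v (f x - f z) \<le> min (v (f x - a)) (v (a - f z)))"
proof (cases "A = {}")
  case False
  define \<gamma> where "\<gamma> = Max ((\<lambda>x. v (f x - a)) ` A)"
  define N where "N = {x\<in>A. v (f x - a) = \<gamma>}"
  have le: "v (f x - a) \<le> \<gamma>" if "x \<in> A" for x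
    unfolding \<gamma>_def using that assms(1) by auto
  have "\<gamma> \<in> (\<lambda>x. v (f x - a)) ` A"
    unfolding \<gamma>_def using False assms(1) by (intro Max_in) auto
  hence N: "N \<noteq> {}" "finite N" using assms(1) unfolding N_def by auto
  obtain x0 where x0: "x0 \<in> N" "\<And>x. x \<in> N \<Longrightarrow> pos x \<le> pos x0"
    using finite_ex_max[OF N(2,1), of pos] by blast
  have x0A: "x0 \<in> A" "v (f x0 - a) = \<gamma>" using x0(1) unfolding N_def by auto
  have near: "v (f x - a) = min (v (f x - f x0)) \<gamma>" if "x \<in> A" for x
    using v_nearest[of "f x" a "f x0"] le[OF that] x0A by simp
  have less: "v (f x - a) < \<gamma>" if "x \<in> A" "pos x0 < pos x" for x
    using le[OF that(1)] x0(2)[of x] that unfolding N_def by (cases "v (f x - a) = \<gamma>") auto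
  have near': "v (f x - a) = v (f x - f x0)" "v (f x - f x0) < \<gamma>" if "x \<in> A" "pos x0 < pos x" for x
    using near[OF that(1)] less[OF that] by (auto simp: min_def split: if_splits)
  have conv: "v (f x - f z) \<le> v (f x - f y)" "v (f x - f z) \<le> v (f y - f z)"
    if "x \<in> A" "y \<in> A" "z \<in> A" "pos x \<le> pos y" "pos y \<le> pos z" for x y z
  proof -
    have "x = y \<or> y = z \<or> pos x < pos y \<and> pos y < pos z"
      using that assms(2) unfolding convex_order_def inj_on_def by force
    thus "v (f x - f z) \<le> v (f x - f y)" "v (f x - f z) \<le> v (f y - f z)"
      using that assms(2) unfolding convex_order_def by fastforce+
  qed
  have "\<exists>q. pos x0 < q \<and> (\<forall>x\<in>{x\<in>A. pos x0 < pos x}. q < pos x)"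
  proof (cases "{x\<in>A. pos x0 < pos x} = {}")
    case True
    thus ?thesis using gt_ex by blast
  next
    case nonempty: False
    define m where "m = Min (pos ` {x\<in>A. pos x0 < pos x})"
    have fin: "finite {x\<in>A. pos x0 < pos x}" using assms(1) by simp
    have "m \<in> pos ` {x\<in>A. pos x0 < pos x}"
      unfolding m_def using nonempty fin by (intro Min_in) auto
    hence "pos x0 < m" by auto
    then obtain q where "pos x0 < q" "q < m" using dense by blast
    moreover have "m \<le> pos x" if "x \<in> {x\<in>A. pos x0 < pos x}" for x
      unfolding m_def using that fin by (intro Min_le) auto
    ultimately show ?thesis by (meson less_le_trans)
  qed
  then obtain q where q: "pos x0 < q" "\<And>x. x \<in> A \<Longrightarrow> pos x0 < pos x \<Longrightarrow> q < pos x" by blast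
  have qle: "pos x \<le> pos x0" if "x \<in> A" "pos x < q" for x
    using q(2)[OF that(1)] that(2) by fastforce
  show ?thesis
  proof (intro exI[of _ q] conjI ballI impI)
    show "q \<notin> pos ` A" using q by (metis imageE less_irrefl not_less qle)
  next
    fix x y assume xy: "x \<in> A" "y \<in> A" "pos x < pos y \<and> pos y < q"
    have "v (f x - f x0) \<le> v (f y - f x0)" using xy qle[of y] x0A by (intro conv) auto
    thus "v (f x - a) \<le> v (f y - a)" using near xy by (auto simp: min_def)
  next
    fix x y assume xy: "x \<in> A" "y \<in> A" "q < pos y \<and> pos y < pos x"
    have "v (f x0 - f x) \<le> v (f x0 - f y)" using xy q(1) x0A by (intro conv) auto
    thus "v (f x - a) \<le> v (f y - a)" using near' xy q(1) by (auto simp: v_minus_commute)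
  next
    fix x z assume xz: "x \<in> A" "z \<in> A" "pos x < q \<and> q < pos z"
    have 1: "v (f x - f z) \<le> v (f x - f x0)" "v (f x - f z) \<le> v (f x0 - f z)"
      using xz qle[of x] q(1) x0A by (auto intro!: conv)
    have 2: "v (f z - a) = v (f z - f x0)" "v (f z - f x0) < \<gamma>" using near'[of z] xz q(1) by auto
    show "v (f x - f z) \<le> min (v (f x - a)) (v (a - f z))"
      using 1 2 near[of x] xz by (simp add: v_minus_commute[of a "f z"] v_minus_commute[of "f x0"])
  qed
qed auto

lemma ex_convex_order:
  assumes "finite A"
  shows "\<exists>pos. convex_order f pos A"
  using assms
proof (induction A rule: finite_induct)
  case (insert a A)
  then obtain pos where pos: "convex_order f pos A" by blast
  obtain q where q: "q \<notin> pos ` A"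
      "\<And>x y. x \<in> A \<Longrightarrow> y \<in> A \<Longrightarrow> pos x < pos y \<Longrightarrow> pos y < q \<Longrightarrow> v (f x - f a) \<le> v (f y - f a)"
      "\<And>x y. x \<in> A \<Longrightarrow> y \<in> A \<Longrightarrow> q < pos y \<Longrightarrow> pos y < pos x \<Longrightarrow> v (f x - f a) \<le> v (f y - f a)"
      "\<And>x z. x \<in> A \<Longrightarrow> z \<in> A \<Longrightarrow> pos x < q \<Longrightarrow> q < pos z \<Longrightarrow>
         v (f x - f z) \<le> min (v (f x - f a)) (v (f a - f z))"
    using convex_order_place[OF insert.hyps(1) pos, of "f a"] by blast
  have "v (f x - f z) \<le> min (v (f x - f y)) (v (f y - f z))"
    if xyz: "x \<in> insert a A" "y \<in> insert a A" "z \<in> insert a A"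
      and less: "(pos(a := q)) x < (pos(a := q)) y" "(pos(a := q)) y < (pos(a := q)) z" for x y z
  proof -
    have dist: "x \<noteq> y" "y \<noteq> z" "x \<noteq> z" using less by auto
    consider "x = a" "y \<in> A" "z \<in> A" | "y = a" "x \<in> A" "z \<in> A" | "z = a" "x \<in> A" "y \<in> A"
      | "x \<in> A" "y \<in> A" "z \<in> A" using xyz dist by blast
    thus ?thesis
    proof cases
      case 1
      hence "v (f z - f a) \<le> v (f y - f a)" using q(3)[of z y] less dist by auto
      thus ?thesis using v_nearest[of "f z" "f a" "f y"] 1(1)
        by (simp add: v_minus_commute)
    next
      case 2
      thus ?thesis using q(4)[of x z] less dist by auto
    next
      case 3
      hence "v (f x - f a) \<le> v (f y - f a)" using q(2)[of x y] less dist by auto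
      thus ?thesis using v_nearest[of "f x" "f a" "f y"] 3(1) by simp
    next
      case 4
      hence "a \<noteq> x" "a \<noteq> y" "a \<noteq> z" using insert.hyps(2) by auto
      thus ?thesis using 4 less pos unfolding convex_order_def by auto
    qed
  qed
  moreover have "inj_on (pos(a := q)) (insert a A)"
    using pos q(1) insert.hyps(2) unfolding convex_order_def by (auto simp: inj_on_def)
  ultimately show ?case unfolding convex_order_def by blast
qed (auto simp: convex_order_def)

section \<open>Range trees for comparisons of distances\<close>

text \<open>
  One cut of \<open>\<rho>\<close> at \<open>c\<close> separates the points where the minimum is the fixed function \<open>\<rho>\<close> from those
  where it is the constant \<open>c\<close>.
\<close>
lemma range_tree_split:
  fixes \<rho> :: "'x \<Rightarrow> ereal"
  assumes fin: "finite A" and card: "card A \<le> 2 ^ k"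
    and rt: "\<And>S. S \<subseteq> A \<Longrightarrow> range_tree S p
      ({{x\<in>S. P (\<rho> x) x} |P. P \<in> \<P>} \<union> {{x\<in>S. P c x} |P c. P \<in> \<P>})"
  shows "range_tree A (2 * (k + 1) * p) {{x\<in>A. P (min (\<rho> x) c) x} |P c. P \<in> \<P>}"
proof -
  let ?C = "cuts \<rho> A"
  have low: "range_tree A ((k + 1) * p) {{x\<in>A. \<rho> x < c \<and> P (\<rho> x) x} |P c. P \<in> \<P>}"
  proof (rule range_tree_compose[OF range_tree_cuts[OF fin card, of \<rho>] rt])
    fix H assume "H \<in> {{x\<in>A. \<rho> x < c \<and> P (\<rho> x) x} |P c. P \<in> \<P>}"
    then obtain P c where H: "H = {x\<in>A. \<rho> x < c \<and> P (\<rho> x) x}" "P \<in> \<P>" by blast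
    have "H \<subseteq> {x\<in>A. \<rho> x < c}" using H(1) by auto
    have "{x\<in>A. \<rho> x < c} \<in> ?C" by auto
    have "H \<inter> S = {x\<in>S. P (\<rho> x) x}" if "S \<subseteq> {x\<in>A. \<rho> x < c}" for S using that H(1) by auto
    hence "\<forall>S\<subseteq>{x\<in>A. \<rho> x < c}. H \<inter> S \<in>
        {{x\<in>S. P (\<rho> x) x} |P. P \<in> \<P>} \<union> {{x\<in>S. P c x} |P c. P \<in> \<P>}"
      using H(2) by auto
    thus "\<exists>F\<in>?C. H \<subseteq> F \<and> (\<forall>S\<subseteq>F. H \<inter> S \<in>
        {{x\<in>S. P (\<rho> x) x} |P. P \<in> \<P>} \<union> {{x\<in>S. P c x} |P c. P \<in> \<P>})"
      using \<open>H \<subseteq> {x\<in>A. \<rho> x < c}\<close> \<open>{x\<in>A. \<rho> x < c} \<in> ?C\<close> by (intro bexI[of _ "{x\<in>A. \<rho> x < c}"] conjI)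
  qed
  have high: "range_tree A ((k + 1) * p) {{x\<in>A. c \<le> \<rho> x \<and> P c x} |P c. P \<in> \<P>}"
  proof (rule range_tree_compose[OF range_tree_cuts[OF fin card, of \<rho>] rt])
    fix H assume "H \<in> {{x\<in>A. c \<le> \<rho> x \<and> P c x} |P c. P \<in> \<P>}"
    then obtain P c where H: "H = {x\<in>A. c \<le> \<rho> x \<and> P c x}" "P \<in> \<P>" by blast
    have "H \<subseteq> {x\<in>A. c \<le> \<rho> x}" using H(1) by auto
    have "{x\<in>A. c \<le> \<rho> x} \<in> ?C" by auto
    have "H \<inter> S = {x\<in>S. P c x}" if "S \<subseteq> {x\<in>A. c \<le> \<rho> x}" for S using that H(1) by auto
    hence "\<forall>S\<subseteq>{x\<in>A. c \<le> \<rho> x}. H \<inter> S \<in>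
        {{x\<in>S. P (\<rho> x) x} |P. P \<in> \<P>} \<union> {{x\<in>S. P c x} |P c. P \<in> \<P>}"
      using H(2) by auto
    thus "\<exists>F\<in>?C. H \<subseteq> F \<and> (\<forall>S\<subseteq>F. H \<inter> S \<in>
        {{x\<in>S. P (\<rho> x) x} |P. P \<in> \<P>} \<union> {{x\<in>S. P c x} |P c. P \<in> \<P>})"
      using \<open>H \<subseteq> {x\<in>A. c \<le> \<rho> x}\<close> \<open>{x\<in>A. c \<le> \<rho> x} \<in> ?C\<close> by (intro bexI[of _ "{x\<in>A. c \<le> \<rho> x}"] conjI)
  qed
  have "range_tree A ((k + 1) * p + (k + 1) * p) {{x\<in>A. P (min (\<rho> x) c) x} |P c. P \<in> \<P>}"
  proof (rule range_tree_Un[OF low high])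
    fix H assume "H \<in> {{x\<in>A. P (min (\<rho> x) c) x} |P c. P \<in> \<P>}"
    then obtain P c where H: "H = {x\<in>A. P (min (\<rho> x) c) x}" "P \<in> \<P>" by blast
    have "H = {x\<in>A. \<rho> x < c \<and> P (\<rho> x) x} \<union> {x\<in>A. c \<le> \<rho> x \<and> P c x}"
    proof (rule set_eqI)
      fix x show "x \<in> H \<longleftrightarrow> x \<in> {x\<in>A. \<rho> x < c \<and> P (\<rho> x) x} \<union> {x\<in>A. c \<le> \<rho> x \<and> P c x}"
        by (cases "\<rho> x < c") (auto simp: H(1) not_less min_absorb1 min_absorb2)
    qed
    thus "\<exists>F\<in>insert {} {{x\<in>A. \<rho> x < c \<and> P (\<rho> x) x} |P c. P \<in> \<P>}.
          \<exists>G\<in>insert {} {{x\<in>A. c \<le> \<rho> x \<and> P c x} |P c. P \<in> \<P>}. H = F \<union> G"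
      using H(2) by blast
  qed
  moreover have "(k + 1) * p + (k + 1) * p = 2 * (k + 1) * p" by simp
  ultimately show ?thesis by (simp only:)
qed

text \<open>
  A distance to a varying point \<open>a\<close> may be replaced by a fixed function or a constant. The place of
  \<open>a\<close> in a convex order cuts \<open>A\<close> into two parts. In a subset \<open>S\<close> of the left part, the last point is
  nearest to \<open>a\<close>, whatever \<open>a\<close> is; so the distance is \<open>min (v (f x - f s)) c\<close> with \<open>s\<close> depending only
  on \<open>S\<close>, as in the preceding lemma. The right part is symmetric.
\<close>
lemma range_tree_distance:
  fixes f :: "'x \<Rightarrow> 'a"
  assumes fin: "finite A" and card: "card A \<le> 2 ^ k"
    and rt: "\<And>S \<rho>. S \<subseteq> A \<Longrightarrow> range_tree S p
      ({{x\<in>S. P (\<rho> x) x} |P. P \<in> \<P>} \<union> {{x\<in>S. P c x} |P c. P \<in> \<P>})"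
  shows "range_tree A (4 * (k + 1)\<^sup>2 * p) {{x\<in>A. P (v (f x - a)) x} |P a. P \<in> \<P>}"
proof -
  obtain pos where pos: "convex_order f pos A" using ex_convex_order[OF fin] by blast
  have "\<forall>a. \<exists>q. q \<notin> pos ` A \<and>
    (\<forall>x\<in>A. \<forall>y\<in>A. pos x < pos y \<and> pos y < q \<longrightarrow> v (f x - a) \<le> v (f y - a)) \<and>
    (\<forall>x\<in>A. \<forall>y\<in>A. q < pos y \<and> pos y < pos x \<longrightarrow> v (f x - a) \<le> v (f y - a))"
    using convex_order_place[OF fin pos] by blast
  then obtain q where q: "\<And>a. q a \<notin> pos ` A"
      "\<And>a x y. x \<in> A \<Longrightarrow> y \<in> A \<Longrightarrow> pos x < pos y \<Longrightarrow> pos y < q a \<Longrightarrow> v (f x - a) \<le> v (f y - a)"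
      "\<And>a x y. x \<in> A \<Longrightarrow> y \<in> A \<Longrightarrow> q a < pos y \<Longrightarrow> pos y < pos x \<Longrightarrow> v (f x - a) \<le> v (f y - a)"
    by metis
  have inj: "x = y" if "x \<in> A" "y \<in> A" "pos x = pos y" for x y
    using that pos unfolding convex_order_def inj_on_def by blast
  have sub: "finite S" "card S \<le> 2 ^ k" if "S \<subseteq> A" for S
    using finite_subset[OF that fin] card_mono[OF fin that] card by auto
  let ?C = "cuts pos A"
  let ?G = "\<lambda>S s. {{x\<in>S. P (min (v (f x - f s)) c) x} |P c. P \<in> \<P>}"
  have G: "range_tree S (2 * (k + 1) * p) (?G S s)" if "S \<subseteq> A" for S s
  proof (rule range_tree_split)
    show "finite S" "card S \<le> 2 ^ k" using sub[OF that] .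
  qed (use rt that in auto)
  define last where "last = (\<lambda>S. SOME s. s \<in> S \<and> (\<forall>x\<in>S. pos x \<le> pos s))"
  define first where "first = (\<lambda>S. SOME s. s \<in> S \<and> (\<forall>x\<in>S. pos s \<le> pos x))"
  have last: "last S \<in> S \<and> (\<forall>x\<in>S. pos x \<le> pos (last S))" if "S \<subseteq> A" "S \<noteq> {}" for S
  proof -
    have "finite S" using that(1) fin finite_subset by blast
    hence "\<exists>s. s \<in> S \<and> (\<forall>x\<in>S. pos x \<le> pos s)"
      using that(2) by (rule finite_ex_max)
    thus ?thesis unfolding last_def by (rule someI_ex)
  qed
  have first: "first S \<in> S \<and> (\<forall>x\<in>S. pos (first S) \<le> pos x)" if "S \<subseteq> A" "S \<noteq> {}" for S
  proof -
    have "finite S" using that(1) fin finite_subset by blast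
    hence "\<exists>s. s \<in> S \<and> (\<forall>x\<in>S. pos s \<le> pos x)"
      using that(2) by (rule finite_ex_min)
    thus ?thesis unfolding first_def by (rule someI_ex)
  qed
  have left: "range_tree A ((k + 1) * (2 * (k + 1) * p))
      {{x\<in>A. pos x < q a \<and> P (v (f x - a)) x} |P a. P \<in> \<P>}"
  proof (rule range_tree_compose[OF range_tree_cuts[OF fin card, of pos] G])
    fix H assume "H \<in> {{x\<in>A. pos x < q a \<and> P (v (f x - a)) x} |P a. P \<in> \<P>}"
    then obtain P a where H: "H = {x\<in>A. pos x < q a \<and> P (v (f x - a)) x}" "P \<in> \<P>" by blast
    have "H \<subseteq> {x\<in>A. pos x < q a}" using H(1) by auto
    have "{x\<in>A. pos x < q a} \<in> ?C" by auto
    have "H \<inter> S \<in> ?G S (last S)" if S: "S \<subseteq> {x\<in>A. pos x < q a}" for S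
    proof -
      have "v (f x - a) = min (v (f x - f (last S))) (v (f (last S) - a))" if "x \<in> S" for x
      proof (rule v_nearest)
        have "last S \<in> S" "pos x \<le> pos (last S)" using last[of S] S that by auto
        thus "v (f x - a) \<le> v (f (last S) - a)"
          using q(2)[of x "last S" a] inj[of x "last S"] S that by (cases "pos x = pos (last S)") auto
      qed
      hence "H \<inter> S = {x\<in>S. P (min (v (f x - f (last S))) (v (f (last S) - a))) x}"
        using S H(1) by auto
      thus ?thesis using H(2) by blast
    qed
    hence "\<forall>S\<subseteq>{x\<in>A. pos x < q a}. H \<inter> S \<in> ?G S (last S)" by simp
    thus "\<exists>F\<in>?C. H \<subseteq> F \<and> (\<forall>S\<subseteq>F. H \<inter> S \<in> ?G S (last S))"
      using \<open>H \<subseteq> {x\<in>A. pos x < q a}\<close> \<open>{x\<in>A. pos x < q a} \<in> ?C\<close> by (intro bexI[of _ "{x\<in>A. pos x < q a}"] conjI)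
  qed
  have right: "range_tree A ((k + 1) * (2 * (k + 1) * p))
      {{x\<in>A. q a < pos x \<and> P (v (f x - a)) x} |P a. P \<in> \<P>}"
  proof (rule range_tree_compose[OF range_tree_cuts[OF fin card, of pos] G])
    fix H assume "H \<in> {{x\<in>A. q a < pos x \<and> P (v (f x - a)) x} |P a. P \<in> \<P>}"
    then obtain P a where H: "H = {x\<in>A. q a < pos x \<and> P (v (f x - a)) x}" "P \<in> \<P>" by blast
    have "H \<subseteq> {x\<in>A. q a < pos x}" using H(1) by auto
    have "{x\<in>A. q a < pos x} \<in> ?C" by auto
    have "H \<inter> S \<in> ?G S (first S)" if S: "S \<subseteq> {x\<in>A. q a < pos x}" for S
    proof -
      have "v (f x - a) = min (v (f x - f (first S))) (v (f (first S) - a))" if "x \<in> S" for x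
      proof (rule v_nearest)
        have "first S \<in> S" "pos (first S) \<le> pos x" using first[of S] S that by auto
        thus "v (f x - a) \<le> v (f (first S) - a)"
          using q(3)[of x "first S" a] inj[of x "first S"] S that by (cases "pos x = pos (first S)") auto
      qed
      hence "H \<inter> S = {x\<in>S. P (min (v (f x - f (first S))) (v (f (first S) - a))) x}"
        using S H(1) by auto
      thus ?thesis using H(2) by blast
    qed
    hence "\<forall>S\<subseteq>{x\<in>A. q a < pos x}. H \<inter> S \<in> ?G S (first S)" by simp
    thus "\<exists>F\<in>?C. H \<subseteq> F \<and> (\<forall>S\<subseteq>F. H \<inter> S \<in> ?G S (first S))"
      using \<open>H \<subseteq> {x\<in>A. q a < pos x}\<close> \<open>{x\<in>A. q a < pos x} \<in> ?C\<close> by (intro bexI[of _ "{x\<in>A. q a < pos x}"] conjI)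
  qed
  have "range_tree A ((k + 1) * (2 * (k + 1) * p) + (k + 1) * (2 * (k + 1) * p))
      {{x\<in>A. P (v (f x - a)) x} |P a. P \<in> \<P>}"
  proof (rule range_tree_Un[OF left right])
    fix H assume "H \<in> {{x\<in>A. P (v (f x - a)) x} |P a. P \<in> \<P>}"
    then obtain P a where H: "H = {x\<in>A. P (v (f x - a)) x}" "P \<in> \<P>" by blast
    have "pos x < q a \<or> q a < pos x" if "x \<in> A" for x
      using q(1)[of a] that by (metis image_eqI linorder_neqE)
    hence "H = {x\<in>A. pos x < q a \<and> P (v (f x - a)) x} \<union> {x\<in>A. q a < pos x \<and> P (v (f x - a)) x}"
      using H(1) by auto
    thus "\<exists>F\<in>insert {} {{x\<in>A. pos x < q a \<and> P (v (f x - a)) x} |P a. P \<in> \<P>}.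
          \<exists>G\<in>insert {} {{x\<in>A. q a < pos x \<and> P (v (f x - a)) x} |P a. P \<in> \<P>}. H = F \<union> G"
      using H(2) by blast
  qed
  moreover have "(k + 1) * (2 * (k + 1) * p) + (k + 1) * (2 * (k + 1) * p) = 4 * (k + 1)\<^sup>2 * p"
    by (simp add: power2_eq_square algebra_simps)
  ultimately show ?thesis by (simp only:)
qed

text \<open>
  The conditions that remain when both distances have been replaced. The first one does not vary, the
  next two are cuts, and the last one is trivial.
\<close>
lemma range_tree_threshold:
  fixes \<rho> \<tau> :: "'x \<Rightarrow> ereal" and R :: "ereal \<Rightarrow> ereal \<Rightarrow> bool"
  assumes fin: "finite A" and card: "card A \<le> 2 ^ k" and R: "R = (<) \<or> R = (\<ge>)"
  shows "range_tree A (2 * k + 3)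
    ({{x\<in>A. R (\<tau> x) (\<rho> x)}} \<union> range (\<lambda>c. {x\<in>A. R c (\<rho> x)}) \<union>
     range (\<lambda>c. {x\<in>A. R (\<tau> x) c}) \<union> range (\<lambda>(c, c'). {x\<in>A. R c c'}))"
    (is "range_tree A _ ?\<H>")
proof -
  let ?C = "\<lambda>h. cuts h A"
  have 1: "range_tree A ((k + 1) + (k + 1)) (?C \<rho> \<union> ?C \<tau>)"
    by (rule range_tree_Un[OF range_tree_cuts[OF fin card, of \<rho>] range_tree_cuts[OF fin card, of \<tau>]])
      auto
  have 2: "range_tree A 1 {{}, {x\<in>A. R (\<tau> x) (\<rho> x)}}"
    by (rule range_tree_fixed[OF fin]) simp
  define C D where "C = ?C \<rho> \<union> ?C \<tau>" and "D = {x\<in>A. R (\<tau> x) (\<rho> x)}"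
  have "range (\<lambda>c. {x\<in>A. R c (\<rho> x)}) \<subseteq> ?C \<rho>" "range (\<lambda>c. {x\<in>A. R (\<tau> x) c}) \<subseteq> ?C \<tau>"
    "range (\<lambda>(c, c'). {x\<in>A. R c c'}) \<subseteq> ?C \<tau>"
    using R by auto
  hence sub: "?\<H> \<subseteq> insert D C"
    unfolding C_def D_def by (intro Un_least) (simp_all add: le_supI1 le_supI2 subset_insertI2)
  have "range_tree A ((k + 1) + (k + 1) + 1) (insert D C)"
  proof (rule range_tree_Un[OF 1 2, folded C_def D_def])
    fix H assume "H \<in> insert D C"
    thus "\<exists>F\<in>insert {} C. \<exists>G\<in>insert {} {{}, D}. H = F \<union> G"
      by (elim insertE) (simp_all add: bexI[of _ H])
  qed
  hence "range_tree A ((k + 1) + (k + 1) + 1) ?\<H>" using sub by (rule range_tree_subset)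
  thus ?thesis by (simp add: eval_nat_numeral)
qed

text \<open>
  The second distance is replaced first, for every fixed function or constant on the left; these
  comparisons are then the conditions to which the replacement of the first distance leads.
\<close>
lemma range_tree_compare:
  fixes f g :: "'x \<Rightarrow> 'a"
  assumes fin: "finite A" and card: "card A \<le> 2 ^ k" and R: "R = (<) \<or> R = (\<ge>)"
  shows "range_tree A (16 * (k + 1) ^ 4 * (2 * k + 3))
    {{x\<in>A. R (v (f x - a)) (v (g x - b))} |a b. True}"
proof -
  have sub: "finite S" "card S \<le> 2 ^ k" if "S \<subseteq> A" for S
    using finite_subset[OF that fin] card_mono[OF fin that] card by auto
  have g: "range_tree S (4 * (k + 1)\<^sup>2 * (2 * k + 3))
      ({{x\<in>S. R (\<tau> x) (v (g x - b))} |b. True} \<union> {{x\<in>S. R c (v (g x - b))} |c b. True})"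
    if "S \<subseteq> A" for S and \<tau> :: "'x \<Rightarrow> ereal"
  proof -
    define \<P> where "\<P> = insert (\<lambda>z x. R (\<tau> x) z) (range (\<lambda>c z (x::'x). R c z))"
    define \<F> where "\<F> = {{x\<in>S. P (v (g x - a)) x} |P a. P \<in> \<P>}"
    have "range_tree S (4 * (k + 1)\<^sup>2 * (2 * k + 3)) \<F>"
      unfolding \<F>_def
    proof (rule range_tree_distance[OF sub[OF that]])
      fix S' and \<rho> :: "'x \<Rightarrow> ereal" assume "S' \<subseteq> S"
      with that have S': "S' \<subseteq> A" by blast
      show "range_tree S' (2 * k + 3) ({{x\<in>S'. P (\<rho> x) x} |P. P \<in> \<P>} \<union> {{x\<in>S'. P c x} |P c. P \<in> \<P>})"
        by (rule range_tree_subset[OF range_tree_threshold[OF sub[OF S'] R, of \<tau> \<rho>]])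
          (auto simp: \<P>_def image_iff)
    qed
    moreover have "{x\<in>S. R (\<tau> x) (v (g x - b))} \<in> \<F>" for b
      unfolding \<F>_def \<P>_def by (intro CollectI exI[of _ "\<lambda>z x. R (\<tau> x) z"] exI[of _ b]) simp
    moreover have "{x\<in>S. R c (v (g x - b))} \<in> \<F>" for c b
      unfolding \<F>_def \<P>_def by (intro CollectI exI[of _ "\<lambda>z x. R c z"] exI[of _ b]) simp
    ultimately show ?thesis by (elim range_tree_subset) blast
  qed
  have "range_tree A (4 * (k + 1)\<^sup>2 * (4 * (k + 1)\<^sup>2 * (2 * k + 3)))
      {{x\<in>A. P (v (f x - a)) x} |P a. P \<in> range (\<lambda>b z x. R z (v (g x - b)))}"
  proof (rule range_tree_distance[OF fin card])
    fix S and \<rho> :: "'x \<Rightarrow> ereal" assume "S \<subseteq> A"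
    show "range_tree S (4 * (k + 1)\<^sup>2 * (2 * k + 3))
       ({{x\<in>S. P (\<rho> x) x} |P. P \<in> range (\<lambda>b z x. R z (v (g x - b)))} \<union>
        {{x\<in>S. P c x} |P c. P \<in> range (\<lambda>b z x. R z (v (g x - b)))})"
      by (rule range_tree_subset[OF g[OF \<open>S \<subseteq> A\<close>, of \<rho>]]) auto
  qed
  moreover have "4 * m\<^sup>2 * (4 * m\<^sup>2 * n) = 16 * m ^ 4 * n" for m n :: nat
    by (simp add: power2_eq_square power4_eq_xxxx)
  ultimately have "range_tree A (16 * (k + 1) ^ 4 * (2 * k + 3))
      {{x\<in>A. P (v (f x - a)) x} |P a. P \<in> range (\<lambda>b z x. R z (v (g x - b)))}" by (simp only:)
  thus ?thesis by (rule range_tree_subset) auto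
qed

end

section \<open>Linear forms and the order of their values\<close>

text \<open>
  A functional on the space of all assignments, rather than a vector of coefficients: substituting a
  form for a variable then is composition.
\<close>
definition linear_form :: "((nat \<Rightarrow> 'a::field) \<Rightarrow> 'a) \<Rightarrow> bool" where
  "linear_form f \<longleftrightarrow>
     (\<forall>e e'. f (\<lambda>j. e j + e' j) = f e + f e') \<and> (\<forall>c e. f (\<lambda>j. c * e j) = c * f e)"

lemma linear_form_zero: "linear_form (\<lambda>_. 0)"
  by (simp add: linear_form_def)

lemma linear_form_diff: "linear_form f \<Longrightarrow> linear_form g \<Longrightarrow> linear_form (\<lambda>e. f e - g e)"
  by (simp add: linear_form_def algebra_simps)

lemma linear_form_scale: "linear_form f \<Longrightarrow> linear_form (\<lambda>e. c * f e)"
  by (simp add: linear_form_def algebra_simps)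

lemma linear_form_subst:
  assumes "linear_form f" "linear_form c"
  shows "linear_form (\<lambda>e. f (e(i := c e)))"
proof -
  have "(\<lambda>j. e j + e' j)(i := c (\<lambda>j. e j + e' j)) = (\<lambda>j. (e(i := c e)) j + (e'(i := c e')) j)" for e e'
    using assms(2) by (auto simp: linear_form_def fun_eq_iff)
  moreover have "(\<lambda>j. b * e j)(i := c (\<lambda>j. b * e j)) = (\<lambda>j. b * (e(i := c e)) j)" for b e
    using assms(2) by (auto simp: linear_form_def fun_eq_iff)
  ultimately show ?thesis using assms(1) by (simp add: linear_form_def del: fun_upd_apply)
qed

lemma linear_form_lterm: "linear_form (\<lambda>e. lterm_val e s)"
  by (induction s) (auto simp: linear_form_def algebra_simps)

lemma linear_form_upd:
  assumes "linear_form f"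
  shows "f (e(i := b + a)) = f (e(i := b)) + f (\<lambda>j. if j = i then 1 else 0) * a"
proof -
  have "e(i := b + a) = (\<lambda>j. (e(i := b)) j + a * (if j = i then 1 else 0))"
    by (auto simp: fun_eq_iff)
  thus ?thesis using assms by (simp add: linear_form_def mult.commute del: fun_upd_apply)
qed

context valued
begin

text \<open>The invariant of the back-and-forth argument.\<close>
definition same_order :: "((nat \<Rightarrow> 'a) \<Rightarrow> 'a) set \<Rightarrow> (nat \<Rightarrow> 'a) \<Rightarrow> (nat \<Rightarrow> 'a) \<Rightarrow> bool" where
  "same_order W e e' \<longleftrightarrow> (\<forall>s\<in>W. \<forall>t\<in>W. v (s e) < v (t e) \<longleftrightarrow> v (s e') < v (t e'))"

lemma same_order_sym: "same_order W e e' \<Longrightarrow> same_order W e' e"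
  by (auto simp: same_order_def)

lemma same_order_mono: "same_order W e e' \<Longrightarrow> V \<subseteq> W \<Longrightarrow> same_order V e e'"
  unfolding same_order_def by blast

lemma same_orderD:
  assumes "same_order W e e'" "s \<in> W" "t \<in> W"
  shows "v (s e) < v (t e) \<longleftrightarrow> v (s e') < v (t e')"
  using assms unfolding same_order_def by blast

lemma v_divide_eq_0:
  assumes "v x = v y" "y \<noteq> 0"
  shows "v (x / y) = 0"
proof -
  note assms
  moreover obtain w where "v y = ereal w" using v_cases[of y] \<open>y \<noteq> 0\<close> by auto
  moreover have "v x = v (x / y) + v y" using v_mult[of "x / y" y] \<open>y \<noteq> 0\<close> by simp
  ultimately show ?thesis by (cases "v (x / y)") auto
qed

lemma v_mult_less_cancel: "c \<noteq> 0 \<Longrightarrow> v (c * x) < v (c * y) \<longleftrightarrow> v x < v y"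
  by (cases c rule: v_cases; cases "v x"; cases "v y") (auto simp: v_mult)

lemma v_diff_neq:
  assumes "v x \<noteq> v y"
  shows "v (x - y) = min (v x) (v y)"
proof (cases "v x \<le> v y")
  case True
  thus ?thesis using v_ultra[of x 0 y] v_ultra[of x y 0] assms by (auto simp: min_def split: if_splits)
next
  case False
  thus ?thesis using v_ultra[of x 0 y] v_ultra[of y x 0] assms
    by (auto simp: min_def v_minus_commute[of y x] split: if_splits)
qed

text \<open>
  Units with distinct residues: either representatives of all nonzero residues, or as many as wanted.
  Start with no unit and add one that is not represented as long as there is one.
\<close>
lemma ex_residues:
  "\<exists>M. finite M \<and> (\<forall>\<mu>\<in>M. v \<mu> = 0) \<and>
     ((\<forall>x. v x = 0 \<longrightarrow> (\<exists>\<mu>\<in>M. v (x - \<mu>) > 0)) \<or>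
      (card M = k \<and> (\<forall>\<mu>\<in>M. \<forall>\<nu>\<in>M. \<mu> \<noteq> \<nu> \<longrightarrow> v (\<mu> - \<nu>) \<le> 0)))"
proof (induction k)
  case (Suc k)
  then obtain M where M: "finite M" "\<forall>\<mu>\<in>M. v \<mu> = 0"
     "(\<forall>x. v x = 0 \<longrightarrow> (\<exists>\<mu>\<in>M. v (x - \<mu>) > 0)) \<or>
      (card M = k \<and> (\<forall>\<mu>\<in>M. \<forall>\<nu>\<in>M. \<mu> \<noteq> \<nu> \<longrightarrow> v (\<mu> - \<nu>) \<le> 0))" by (elim exE conjE)
  show ?case
  proof (cases "\<forall>x. v x = 0 \<longrightarrow> (\<exists>\<mu>\<in>M. v (x - \<mu>) > 0)")
    case True
    thus ?thesis using M(1,2) by (intro exI[of _ M]) simp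
  next
    case False
    then obtain x where x: "v x = 0" "\<forall>\<mu>\<in>M. \<not> v (x - \<mu>) > 0" by blast
    have "x \<notin> M" using x(2) by auto
    moreover have "card M = k \<and> (\<forall>\<mu>\<in>M. \<forall>\<nu>\<in>M. \<mu> \<noteq> \<nu> \<longrightarrow> v (\<mu> - \<nu>) \<le> 0)" using M(3) False by blast
    ultimately have "card (insert x M) = Suc k"
        "\<forall>\<mu>\<in>insert x M. \<forall>\<nu>\<in>insert x M. \<mu> \<noteq> \<nu> \<longrightarrow> v (\<mu> - \<nu>) \<le> 0"
      using M(1) x(2) by (auto simp: not_less v_minus_commute[of _ x])
    thus ?thesis using M(1,2) x(1) by (intro exI[of _ "insert x M"]) simp
  qed
qed (intro exI[of _ "{}"], simp)

text \<open>
  Whether some value lies strictly between \<open>v s\<close> and \<open>v t\<close> is itself a comparison of linear forms. If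
  the value group is dense, take \<open>\<kappa> = 1\<close>. Otherwise it is discrete, and \<open>\<kappa>\<close> is an element of least
  positive value: the quotient of the two ends of a gap.
\<close>
lemma ex_gap_scale:
  assumes nontrivial: "0 < v \<pi>" "\<pi> \<noteq> 0"
  shows "\<exists>\<kappa>. \<forall>s t. (\<exists>b. v s < v b \<and> v b < v t) \<longleftrightarrow> v (\<kappa> * s) < v t"
proof (cases "\<forall>s t. v s < v t \<longrightarrow> (\<exists>b. v s < v b \<and> v b < v t)")
  case True
  thus ?thesis by (intro exI[of _ 1]) (auto intro: less_trans)
next
  case False
  then obtain s t where st0: "v s < v t" "\<not> (\<exists>b. v s < v b \<and> v b < v t)" by blast
  have st: "v s < v t" "\<And>b. v s < v b \<Longrightarrow> v t \<le> v b"
    using st0 by (blast, meson not_less)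
  obtain x where s: "s \<noteq> 0" "v s = ereal x"
    using st(1) by (cases s rule: v_cases) auto
  obtain w where w: "v \<pi> = ereal w" "w > 0"
    using nontrivial by (cases \<pi> rule: v_cases) auto
  have "v t \<le> v (\<pi> * s)" using st(2)[of "\<pi> * s"] s w by (simp add: v_mult)
  hence "v t < \<infinity>" using s w by (auto simp: v_mult)
  then obtain y where y: "v t = ereal y" "x < y"
    using st(1) s by (cases t rule: v_cases) auto
  define \<kappa> where "\<kappa> = t / s"
  have "v t = v \<kappa> + v s" using s v_mult[of \<kappa> s] by (simp add: \<kappa>_def)
  hence k: "v \<kappa> = ereal (y - x)" using s y by (cases "v \<kappa>") auto
  have "(\<exists>b. v a < v b \<and> v b < v c) \<longleftrightarrow> v (\<kappa> * a) < v c" for a c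
  proof
    assume "\<exists>b. v a < v b \<and> v b < v c"
    then obtain b where b: "v a < v b" "v b < v c" by blast
    obtain a' where a': "a \<noteq> 0" "v a = ereal a'" using b(1) by (cases a rule: v_cases) auto
    obtain b' where b': "b \<noteq> 0" "v b = ereal b'" using b(2) by (cases b rule: v_cases) auto
    have "v b = v (b / a) + v a" using v_mult[of "b / a" a] a' by simp
    hence ba: "v (b / a) = ereal (b' - a')" using a' b' by (cases "v (b / a)") auto
    have sba: "v (s * (b / a)) = ereal (x + (b' - a'))" by (simp only: v_mult s ba) simp
    have "v t \<le> v (s * (b / a))"
      using b(1) a' b' s sba by (intro st(2)) simp
    hence "y - x \<le> b' - a'" using y sba by simp
    hence "v (\<kappa> * a) \<le> v b" using a' b' k by (simp add: v_mult)
    thus "v (\<kappa> * a) < v c" using b(2) by simp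
  next
    assume less: "v (\<kappa> * a) < v c"
    have "a \<noteq> 0" using less by auto
    then obtain a' where "v a = ereal a'" by (cases a rule: v_cases) auto
    hence "v a < v (\<kappa> * a)" using k y by (simp add: v_mult)
    thus "\<exists>b. v a < v b \<and> v b < v c" using less by blast
  qed
  thus ?thesis by blast
qed

text \<open>
  A value can be copied in its position among the values of \<open>U\<close>. If it is attained in \<open>U\<close>, the same
  form attains the copy; below all of \<open>U\<close>, divide a form of least value by \<open>\<pi>\<close>, or take \<open>1\<close> if all values are \<open>\<infinity>\<close>; between two neighbours of
  \<open>U\<close>, the gap exists on the other side because \<open>\<kappa>\<close> detects it. The zero form provides an upper
  neighbour, the value \<open>\<infinity>\<close>.
\<close>
lemma position_transfer:
  assumes \<pi>: "0 < v \<pi>" "\<pi> \<noteq> 0"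
    and \<kappa>: "\<And>s t. (\<exists>b. v s < v b \<and> v b < v t) \<longleftrightarrow> v (\<kappa> * s) < v t"
    and U: "finite U" "(\<lambda>_. 0) \<in> U"
    and same: "same_order (U \<union> (\<lambda>u e. \<kappa> * u e) ` U) e e'"
    and r: "r \<noteq> 0"
  shows "\<exists>r'. \<forall>u\<in>U. (v (u e) < v r \<longleftrightarrow> v (u e') < v r') \<and> (v r < v (u e) \<longleftrightarrow> v r' < v (u e'))"
proof -
  have sameU: "same_order U e e'" using same by (rule same_order_mono) blast
  have "v r < \<infinity>" using r by simp
  show ?thesis
  proof (cases "\<exists>u\<in>U. v (u e) = v r")
    case True
    then obtain u where u: "u \<in> U" "v (u e) = v r" by blast
    show ?thesis
    proof (intro exI[of _ "u e'"] ballI)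
      fix w assume "w \<in> U"
      thus "(v (w e) < v r \<longleftrightarrow> v (w e') < v (u e')) \<and> (v r < v (w e) \<longleftrightarrow> v (u e') < v (w e'))"
        using same_orderD[OF sameU _ u(1), of w] same_orderD[OF sameU u(1), of w] u(2) by simp
    qed
  next
    case neq: False
    show ?thesis
    proof (cases "{u\<in>U. v (u e) < v r} = {}")
      case True
      obtain u where u: "u \<in> U" "\<And>w. w \<in> U \<Longrightarrow> v (u e') \<le> v (w e')"
        using finite_ex_min[of U "\<lambda>u. v (u e')"] U by blast
      define r' where "r' = (if u e' = 0 then 1 else u e' / \<pi>)"
      have "v r' < v (u e')"
      proof (cases "u e' = 0")
        case False
        then obtain x where "v (u e') = ereal x" by (cases "u e'" rule: v_cases) auto
        moreover obtain w where "v \<pi> = ereal w" "w > 0" using \<pi> by (cases \<pi> rule: v_cases) auto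
        moreover have "v (u e') = v (u e' / \<pi>) + v \<pi>" using v_mult[of "u e' / \<pi>" \<pi>] \<pi> by simp
        ultimately show ?thesis using False unfolding r'_def by (cases "v (u e' / \<pi>)") auto
      qed (simp add: r'_def)
      hence below: "v r' < v (w e')" if "w \<in> U" for w using u(2)[OF that] by simp
      show ?thesis
      proof (intro exI[of _ r'] ballI)
        fix w assume w: "w \<in> U"
        hence "\<not> v (w e) < v r" "v (w e) \<noteq> v r" using True neq by blast+
        thus "(v (w e) < v r \<longleftrightarrow> v (w e') < v r') \<and> (v r < v (w e) \<longleftrightarrow> v r' < v (w e'))"
          using below[OF w] by auto
      qed
    next
      case False
      have "finite {u\<in>U. v (u e) < v r}" "finite {u\<in>U. v r < v (u e)}" using U(1) by auto
      moreover have "{u\<in>U. v r < v (u e)} \<noteq> {}" using U(2) \<open>v r < \<infinity>\<close> by auto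
      ultimately obtain lo hi where
        lo: "lo \<in> U" "v (lo e) < v r" "\<And>u. u \<in> U \<Longrightarrow> v (u e) < v r \<Longrightarrow> v (u e) \<le> v (lo e)" and
        hi: "hi \<in> U" "v r < v (hi e)" "\<And>u. u \<in> U \<Longrightarrow> v r < v (u e) \<Longrightarrow> v (hi e) \<le> v (u e)"
        using False finite_ex_max[of "{u\<in>U. v (u e) < v r}" "\<lambda>u. v (u e)"]
          finite_ex_min[of "{u\<in>U. v r < v (u e)}" "\<lambda>u. v (u e)"] by auto
      have "v (\<kappa> * lo e) < v (hi e)" using lo(2) hi(2) \<kappa> by blast
      hence "v (\<kappa> * lo e') < v (hi e')"
        using same_orderD[OF same, of "\<lambda>e. \<kappa> * lo e" hi] lo(1) hi(1) by auto
      then obtain r' where r': "v (lo e') < v r'" "v r' < v (hi e')" using \<kappa> by blast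
      show ?thesis
      proof (intro exI[of _ r'] ballI)
        fix w assume w: "w \<in> U"
        show "(v (w e) < v r \<longleftrightarrow> v (w e') < v r') \<and> (v r < v (w e) \<longleftrightarrow> v r' < v (w e'))"
        proof (cases "v (w e) < v r")
          case True
          hence "\<not> v (lo e) < v (w e)" using lo(3)[OF w] by simp
          hence "v (w e') \<le> v (lo e')" using same_orderD[OF sameU lo(1) w] by simp
          thus ?thesis using True r' by auto
        next
          case False
          hence "v r < v (w e)" using neq w by (metis linorder_neqE)
          moreover from this have "\<not> v (w e) < v (hi e)" using hi(3)[OF w] by simp
          hence "v (hi e') \<le> v (w e')" using same_orderD[OF sameU w hi(1)] by simp
          ultimately show ?thesis using r' by auto
        qed
      qed
    qed
  qed
qed

text \<open>
  Here \<open>a\<close> has the value of \<open>d\<close> and branches off from all points of \<open>N\<close> at that value or before; the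
  claim is that some multiple \<open>\<mu> * d\<close> does the same in the other assignment. If \<open>M\<close> represents all
  residues, the multiplier that approximates \<open>a\<close> in the first assignment works in the second one,
  because this is a comparison of forms. Otherwise no transfer is needed: each point of \<open>N\<close> excludes
  at most one multiplier, and \<open>M\<close> has more elements than \<open>N\<close>.
\<close>
lemma residue_transfer:
  assumes M: "finite M" "\<forall>\<mu>\<in>M. v \<mu> = 0"
     "(\<forall>x. v x = 0 \<longrightarrow> (\<exists>\<mu>\<in>M. v (x - \<mu>) > 0)) \<or>
      (card M = Suc (card N) \<and> (\<forall>\<mu>\<in>M. \<forall>\<nu>\<in>M. \<mu> \<noteq> \<nu> \<longrightarrow> v (\<mu> - \<nu>) \<le> 0))"
    and N: "finite N" "d \<in> N" and nz: "d e \<noteq> 0" "d e' \<noteq> 0"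
    and a: "v a = v (d e)" "\<And>c. c \<in> N \<Longrightarrow> v (a - c e) \<le> v (d e)"
    and same: "same_order ((\<lambda>(\<mu>, c) e. \<mu> * d e - c e) ` (M \<times> N) \<union> N) e e'"
  shows "\<exists>\<mu>\<in>M. \<forall>c\<in>N. v (\<mu> * d e' - c e') \<le> v (d e')"
  using M(3)
proof
  assume "\<forall>x. v x = 0 \<longrightarrow> (\<exists>\<mu>\<in>M. v (x - \<mu>) > 0)"
  moreover have "v (a / d e) = 0" using v_divide_eq_0[OF a(1) nz(1)] .
  ultimately obtain \<mu> where \<mu>: "\<mu> \<in> M" "v (a / d e - \<mu>) > 0" by blast
  have "a - \<mu> * d e = d e * (a / d e - \<mu>)" using nz(1) by (simp add: field_simps)
  hence "v (a - \<mu> * d e) > v (d e)"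
    using v_mult_less_cancel[OF nz(1), of 1 "a / d e - \<mu>"] \<mu>(2) by simp
  hence "\<not> v (d e) < v (\<mu> * d e - c e)" if "c \<in> N" for c
    using v_ultra[of a "\<mu> * d e" "c e"] a(2)[OF that] by (auto simp: min_def split: if_splits)
  moreover have "v (d e) < v (\<mu> * d e - c e) \<longleftrightarrow> v (d e') < v (\<mu> * d e' - c e')" if "c \<in> N" for c
    using same_orderD[OF same, of d "\<lambda>e. \<mu> * d e - c e"] that \<mu>(1) N(2) by force
  ultimately show ?thesis using \<mu>(1) by (intro bexI[of _ \<mu>]) (auto simp: not_less)
next
  assume M': "card M = Suc (card N) \<and> (\<forall>\<mu>\<in>M. \<forall>\<nu>\<in>M. \<mu> \<noteq> \<nu> \<longrightarrow> v (\<mu> - \<nu>) \<le> 0)"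
  show ?thesis
  proof (rule ccontr)
    assume "\<not> ?thesis"
    hence "\<forall>\<mu>\<in>M. \<exists>c. c \<in> N \<and> v (d e') < v (\<mu> * d e' - c e')" by (auto simp: not_le)
    then obtain c where c: "\<And>\<mu>. \<mu> \<in> M \<Longrightarrow> c \<mu> \<in> N \<and> v (d e') < v (\<mu> * d e' - c \<mu> e')" by metis
    have "card (c ` M) \<le> card N" using c by (intro card_mono[OF N(1)]) auto
    hence "\<not> inj_on c M" using M' card_image[of c M] by auto
    then obtain \<mu> \<nu> where \<mu>\<nu>: "\<mu> \<in> M" "\<nu> \<in> M" "\<mu> \<noteq> \<nu>" "c \<mu> = c \<nu>" unfolding inj_on_def by blast
    have "v (d e') < v (\<mu> * d e' - \<nu> * d e')"
      using v_ultra[of "\<mu> * d e'" "c \<mu> e'" "\<nu> * d e'"] c[OF \<mu>\<nu>(1)] c[OF \<mu>\<nu>(2)] \<mu>\<nu>(4)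
        v_minus_commute[of "c \<mu> e'" "\<nu> * d e'"] by (auto simp: min_def split: if_splits)
    also have "\<mu> * d e' - \<nu> * d e' = d e' * (\<mu> - \<nu>)" by (simp add: algebra_simps)
    finally have "0 < v (\<mu> - \<nu>)" using v_mult_less_cancel[OF nz(2), of 1 "\<mu> - \<nu>"] by simp
    thus False using M' \<mu>\<nu> by (meson leD)
  qed
qed

end

section \<open>Elimination of quantifiers\<close>

lemma min_less_min_iff:
  fixes a b c d :: "'l::linorder"
  shows "min a b < min c d \<longleftrightarrow> (a < c \<and> a < d) \<or> (b < c \<and> b < d)"
  by (auto simp: min_less_iff_disj)

context valued
begin

lemma ereal_add_less_iff: "(x :: ereal) \<noteq> \<infinity> \<Longrightarrow> x \<noteq> -\<infinity> \<Longrightarrow> x + y < x + z \<longleftrightarrow> y < z"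
  by (cases x; cases y; cases z) auto

text \<open>
  Take \<open>c0\<close> in \<open>N\<close> nearest to \<open>a\<close>. Then the value \<open>v (a - c0 e)\<close> alone determines all the values
  \<open>v (a - c e)\<close>, by the nearest point law, and it is this value that has to be copied, together with
  the law. The law holds automatically for \<open>a'\<close> unless the copied value is one of the distances
  between points of \<open>N\<close>; in that case the new point has to branch off in a fresh direction.
\<close>
lemma point_transfer:
  assumes \<pi>: "0 < v \<pi>" "\<pi> \<noteq> 0"
    and \<kappa>: "\<And>s t. (\<exists>b. v s < v b \<and> v b < v t) \<longleftrightarrow> v (\<kappa> * s) < v t"
    and M: "finite M" "\<forall>\<mu>\<in>M. v \<mu> = 0"
     "(\<forall>x. v x = 0 \<longrightarrow> (\<exists>\<mu>\<in>M. v (x - \<mu>) > 0)) \<or>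
      (card M = Suc (card N) \<and> (\<forall>\<mu>\<in>M. \<forall>\<nu>\<in>M. \<mu> \<noteq> \<nu> \<longrightarrow> v (\<mu> - \<nu>) \<le> 0))"
    and N: "finite N" "N \<noteq> {}"
    and U: "finite U" "(\<lambda>_. 0) \<in> U" "\<forall>c\<in>N. \<forall>d\<in>N. (\<lambda>e. c e - d e) \<in> U"
    and same: "same_order (U \<union> (\<lambda>u e. \<kappa> * u e) ` U \<union>
      (\<lambda>(\<mu>, c, d, b) e. \<mu> * (d e - b e) - (c e - b e)) ` (M \<times> N \<times> N \<times> N)) e e'"
  obtains c0 a' where "c0 \<in> N"
    "\<And>c. c \<in> N \<Longrightarrow> v (a - c e) = min (v (a - c0 e)) (v (c0 e - c e))"
    "\<And>c. c \<in> N \<Longrightarrow> v (a' - c e') = min (v (a' - c0 e')) (v (c0 e' - c e'))"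
    "\<And>u. u \<in> U \<Longrightarrow> v (u e) < v (a - c0 e) \<longleftrightarrow> v (u e') < v (a' - c0 e')"
    "\<And>u. u \<in> U \<Longrightarrow> v (a - c0 e) < v (u e) \<longleftrightarrow> v (a' - c0 e') < v (u e')"
proof -
  have sameU: "same_order U e e'" using same by (rule same_order_mono) blast
  obtain c0 where c0: "c0 \<in> N" "\<And>c. c \<in> N \<Longrightarrow> v (a - c e) \<le> v (a - c0 e)"
    using finite_ex_max[OF N, of "\<lambda>c. v (a - c e)"] by blast
  have near: "v (b - c g) = min (v (b - c0 g)) (v (c0 g - c g))"
    if "v (b - c g) \<le> v (b - c0 g)" for b c g
    using v_nearest[of "c g" b "c0 g"] that
    by (simp add: v_minus_commute[of _ b] v_minus_commute[of "c g" "c0 g"] min.commute)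
  have near_e: "v (a - c e) = min (v (a - c0 e)) (v (c0 e - c e))" if "c \<in> N" for c
    using near[of a c e, OF c0(2)[OF that]] .
  consider (center) "a = c0 e"
    | (branch) d where "a \<noteq> c0 e" "d \<in> N" "v (a - c0 e) = v (d e - c0 e)"
    | (generic) "a \<noteq> c0 e" "\<And>d. d \<in> N \<Longrightarrow> v (a - c0 e) \<noteq> v (d e - c0 e)" by blast
  thus thesis
  proof cases
    case center
    show thesis
    proof (rule that[of c0 "c0 e'"])
      show "c0 \<in> N" by (rule c0(1))
      show "v (a - c e) = min (v (a - c0 e)) (v (c0 e - c e))" if "c \<in> N" for c
        using that by (rule near_e)
      show "v (c0 e' - c e') = min (v (c0 e' - c0 e')) (v (c0 e' - c e'))" for c
        using v_eq_infinity_iff[of 0] by (simp add: min_def)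
      show "v (u e) < v (a - c0 e) \<longleftrightarrow> v (u e') < v (c0 e' - c0 e')" if "u \<in> U" for u
        using same_orderD[OF sameU that U(2)] center by simp
      show "v (a - c0 e) < v (u e) \<longleftrightarrow> v (c0 e' - c0 e') < v (u e')" if "u \<in> U" for u
        using center by simp
    qed
  next
    case branch
    define N0 where "N0 = (\<lambda>c e. c e - c0 e) ` N"
    define d0 where "d0 = (\<lambda>e. d e - c0 e)"
    have d0U: "d0 \<in> U" unfolding d0_def using U(3) branch(2) c0(1) by blast
    have ne: "d0 e \<noteq> 0" using branch(1,3) v_eq_infinity_iff[of "a - c0 e"]
      unfolding d0_def by (metis right_minus_eq v_eq_infinity_iff)
    hence ne': "d0 e' \<noteq> 0"
      using same_orderD[OF sameU d0U U(2)] by simp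
    have inj: "inj_on (\<lambda>c e. c e - c0 e) N" by (auto simp: inj_on_def fun_eq_iff)
    have "\<exists>\<mu>\<in>M. \<forall>c\<in>N0. v (\<mu> * d0 e' - c e') \<le> v (d0 e')"
    proof (rule residue_transfer[OF M(1,2)])
      show "(\<forall>x. v x = 0 \<longrightarrow> (\<exists>\<mu>\<in>M. v (x - \<mu>) > 0)) \<or>
        (card M = Suc (card N0) \<and> (\<forall>\<mu>\<in>M. \<forall>\<nu>\<in>M. \<mu> \<noteq> \<nu> \<longrightarrow> v (\<mu> - \<nu>) \<le> 0))"
        using M(3) card_image[OF inj] unfolding N0_def by simp
      show "finite N0" "d0 \<in> N0" unfolding N0_def d0_def using N(1) branch(2) by auto
      show "v (a - c0 e) = v (d0 e)" using branch(3) unfolding d0_def .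
      show "v (a - c0 e - c e) \<le> v (d0 e)" if "c \<in> N0" for c
        using that c0(2) branch(3) unfolding N0_def d0_def by auto
      have "(\<lambda>(\<mu>, c) e. \<mu> * d0 e - c e) ` (M \<times> N0) \<subseteq>
          (\<lambda>(\<mu>, c, d, b) e. \<mu> * (d e - b e) - (c e - b e)) ` (M \<times> N \<times> N \<times> N)"
      proof (rule image_subsetI)
        fix x assume "x \<in> M \<times> N0"
        then obtain \<mu> c where x: "x = (\<mu>, \<lambda>e. c e - c0 e)" "\<mu> \<in> M" "c \<in> N" unfolding N0_def by blast
        have "(\<lambda>(\<mu>, c) e. \<mu> * d0 e - c e) x = (\<lambda>(\<mu>, c, d, b) e. \<mu> * (d e - b e) - (c e - b e)) (\<mu>, c, d, c0)"
          unfolding x(1) d0_def by simp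
        thus "(\<lambda>(\<mu>, c) e. \<mu> * d0 e - c e) x \<in>
          (\<lambda>(\<mu>, c, d, b) e. \<mu> * (d e - b e) - (c e - b e)) ` (M \<times> N \<times> N \<times> N)"
          using x(2,3) branch(2) c0(1) by (intro image_eqI[of _ _ "(\<mu>, c, d, c0)"]) auto
      qed
      moreover have "N0 \<subseteq> U" unfolding N0_def using U(3) c0(1) by blast
      ultimately show "same_order ((\<lambda>(\<mu>, c) e. \<mu> * d0 e - c e) ` (M \<times> N0) \<union> N0) e e'"
        by (intro same_order_mono[OF same]) auto
    qed (use ne ne' in auto)
    then obtain \<mu> where \<mu>: "\<mu> \<in> M" "\<And>c. c \<in> N \<Longrightarrow> v (\<mu> * d0 e' - (c e' - c0 e')) \<le> v (d0 e')"
      unfolding N0_def by auto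
    define a' where "a' = c0 e' + \<mu> * d0 e'"
    have va': "v (a' - c0 e') = v (d0 e')" unfolding a'_def using M(2) \<mu>(1) by (simp add: v_mult)
    have va: "v (a - c0 e) = v (d0 e)" using branch(3) unfolding d0_def .
    show thesis
    proof (rule that[of c0 "a'"])
      show "c0 \<in> N" by (rule c0(1))
      show "v (a - c e) = min (v (a - c0 e)) (v (c0 e - c e))" if "c \<in> N" for c
        using that by (rule near_e)
      show "v (a' - c e') = min (v (a' - c0 e')) (v (c0 e' - c e'))" if "c \<in> N" for c
        using \<mu>(2)[OF that] by (intro near) (simp add: va', simp add: a'_def algebra_simps)
      show "v (u e) < v (a - c0 e) \<longleftrightarrow> v (u e') < v (a' - c0 e')" if "u \<in> U" for u
        using same_orderD[OF sameU that d0U] va va' by simp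
      show "v (a - c0 e) < v (u e) \<longleftrightarrow> v (a' - c0 e') < v (u e')" if "u \<in> U" for u
        using same_orderD[OF sameU d0U that] va va' by simp
    qed
  next
    case generic
    have same': "same_order (U \<union> (\<lambda>u e. \<kappa> * u e) ` U) e e'"
      using same by (rule same_order_mono) (rule Un_upper1)
    have "a - c0 e \<noteq> 0" using generic(1) by simp
    from position_transfer[OF \<pi> \<kappa> U(1,2) same' this]
    obtain r where "\<forall>u\<in>U. (v (u e) < v (a - c0 e) \<longleftrightarrow> v (u e') < v r) \<and>
        (v (a - c0 e) < v (u e) \<longleftrightarrow> v r < v (u e'))"
      by (elim exE)
    hence r: "v (u e) < v (a - c0 e) \<longleftrightarrow> v (u e') < v r" "v (a - c0 e) < v (u e) \<longleftrightarrow> v r < v (u e')"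
      if "u \<in> U" for u using that by simp_all
    show thesis
    proof (rule that[of c0 "c0 e' + r"])
      show "c0 \<in> N" by (rule c0(1))
      show "v (a - c e) = min (v (a - c0 e)) (v (c0 e - c e))" if "c \<in> N" for c
        using that by (rule near_e)
      show "v (c0 e' + r - c e') = min (v (c0 e' + r - c0 e')) (v (c0 e' - c e'))" if "c \<in> N" for c
      proof -
        have "v (a - c0 e) \<noteq> v (c e - c0 e)" using generic(2)[OF that] .
        hence "v r \<noteq> v (c e' - c0 e')"
          using r[OF U(3)[rule_format, OF that c0(1)]] by (metis linorder_neqE less_irrefl)
        hence "v (r - (c e' - c0 e')) = min (v r) (v (c e' - c0 e'))" by (rule v_diff_neq)
        moreover have "r - (c e' - c0 e') = c0 e' + r - c e'" by simp
        ultimately show ?thesis using v_minus_commute[of "c e'" "c0 e'"] by simp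
      qed
      show "v (u e) < v (a - c0 e) \<longleftrightarrow> v (u e') < v (c0 e' + r - c0 e')" if "u \<in> U" for u
        using r(1)[OF that] by simp
      show "v (a - c0 e) < v (u e) \<longleftrightarrow> v (c0 e' + r - c0 e') < v (u e')" if "u \<in> U" for u
        using r(2)[OF that] by simp
    qed
  qed
qed

text \<open>
  As a function of the variable \<open>i\<close>, a form \<open>s\<close> is affine with slope \<open>slope s\<close>, and with zero \<open>center s\<close>
  if the slope is not \<open>0\<close>. With \<open>c0\<close> nearest to \<open>a\<close> among the zeros, the value of \<open>s\<close> at \<open>a\<close> is
  the minimum of \<open>v (slope s) + v (a - c0)\<close> and the value of \<open>s\<close> at \<open>c0\<close>, also for slope \<open>0\<close>, since
  \<open>v 0 = \<infinity>\<close>. So it suffices to preserve the comparisons among these two kinds of values, and dividing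
  by slopes turns them into statements about the position of \<open>v (a - c0)\<close> among forms without the
  variable.
\<close>
lemma eliminate_variable:
  assumes \<pi>: "0 < v \<pi>" "\<pi> \<noteq> 0" and W: "finite W" "\<forall>s\<in>W. linear_form s"
  shows "\<exists>W'. finite W' \<and> (\<forall>s\<in>W'. linear_form s) \<and>
    (\<forall>e e' a. same_order W' e e' \<longrightarrow> (\<exists>a'. same_order W (e(i := a)) (e'(i := a'))))"
proof -
  obtain \<kappa> where \<kappa>: "\<And>s t. (\<exists>b. v s < v b \<and> v b < v t) \<longleftrightarrow> v (\<kappa> * s) < v t"
    using ex_gap_scale[OF \<pi>] by blast
  define slope :: "((nat \<Rightarrow> 'a) \<Rightarrow> 'a) \<Rightarrow> 'a" where "slope = (\<lambda>s. s (\<lambda>j. if j = i then 1 else 0))"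
  define center :: "((nat \<Rightarrow> 'a) \<Rightarrow> 'a) \<Rightarrow> (nat \<Rightarrow> 'a) \<Rightarrow> 'a"
    where "center = (\<lambda>s e. (- inverse (slope s)) * s (e(i := 0)))"
  define value_at :: "((nat \<Rightarrow> 'a) \<Rightarrow> 'a) \<Rightarrow> ((nat \<Rightarrow> 'a) \<Rightarrow> 'a) \<Rightarrow> (nat \<Rightarrow> 'a) \<Rightarrow> 'a"
    where "value_at = (\<lambda>s c e. s (e(i := c e)))"
  (* The additional centre 0 makes N nonempty; for slope 0, center gives the default value 0. *)
  define N where "N = insert (\<lambda>_. 0) (center ` W)"
  define U where "U = insert (\<lambda>_. 0) ((\<lambda>(c, d) e. c e - d e) ` (N \<times> N) \<union>
    (\<lambda>(s, t, c) e. inverse (slope t) * value_at s c e) ` (W \<times> W \<times> N))"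
  have "linear_form (center s)" if "s \<in> W" for s
    unfolding center_def
    by (rule linear_form_scale[OF linear_form_subst[OF _ linear_form_zero]]) (use W(2) that in blast)
  hence N: "finite N" "N \<noteq> {}" "\<forall>c\<in>N. linear_form c"
    unfolding N_def using W(1) by (simp_all add: linear_form_zero)
  have value_at: "linear_form (value_at s c)" if "s \<in> W" "c \<in> N" for s c
    unfolding value_at_def by (rule linear_form_subst) (use W(2) N(3) that in simp_all)
  have U: "finite U" "(\<lambda>_. 0) \<in> U"
    unfolding U_def using W(1) N(1) by simp_all
  have U_diff: "\<forall>c\<in>N. \<forall>d\<in>N. (\<lambda>e. c e - d e) \<in> U"
  proof (intro ballI)
    fix c d assume "c \<in> N" "d \<in> N"
    thus "(\<lambda>e. c e - d e) \<in> U"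
      unfolding U_def by (intro insertI2 UnI1 image_eqI[of _ _ "(c, d)"]) simp_all
  qed
  have U_value: "(\<lambda>e. inverse (slope t) * value_at s c e) \<in> U" if "s \<in> W" "t \<in> W" "c \<in> N" for s t c
    unfolding U_def using that by (intro insertI2 UnI2 image_eqI[of _ _ "(s, t, c)"]) simp_all
  have linU: "linear_form u" if "u \<in> U" for u
    using that unfolding U_def
    by (elim insertE UnE imageE SigmaE)
      (simp_all add: N(3) value_at linear_form_zero linear_form_diff linear_form_scale)
  obtain M where M: "finite M" "\<forall>\<mu>\<in>M. v \<mu> = 0"
     "(\<forall>x. v x = 0 \<longrightarrow> (\<exists>\<mu>\<in>M. v (x - \<mu>) > 0)) \<or>
      (card M = Suc (card N) \<and> (\<forall>\<mu>\<in>M. \<forall>\<nu>\<in>M. \<mu> \<noteq> \<nu> \<longrightarrow> v (\<mu> - \<nu>) \<le> 0))"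
    using ex_residues[of "Suc (card N)"] by blast
  define W1 where "W1 = U \<union> (\<lambda>u e. \<kappa> * u e) ` U \<union>
      (\<lambda>(\<mu>, c, d, b) e. \<mu> * (d e - b e) - (c e - b e)) ` (M \<times> N \<times> N \<times> N)"
  define W2 where "W2 = (\<lambda>(s, c). value_at s c) ` (W \<times> N)"
  have "finite (W1 \<union> W2)" unfolding W1_def W2_def using W(1) N(1) U(1) M(1) by auto
  moreover have "\<forall>s\<in>W1 \<union> W2. linear_form s"
  proof
    fix w assume "w \<in> W1 \<union> W2"
    thus "linear_form w"
      unfolding W1_def W2_def
      by (elim UnE imageE SigmaE)
        (simp_all add: linU N(3) value_at linear_form_diff linear_form_scale)
  qed
  moreover have "\<exists>a'. same_order W (e(i := a)) (e'(i := a'))" if same: "same_order (W1 \<union> W2) e e'" for e e' a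
  proof -
    have same1: "same_order W1 e e'" and same2: "same_order W2 e e'"
      using same by (blast intro: same_order_mono)+
    obtain c0 a' where c0: "c0 \<in> N"
      and near: "\<And>c. c \<in> N \<Longrightarrow> v (a - c e) = min (v (a - c0 e)) (v (c0 e - c e))"
        "\<And>c. c \<in> N \<Longrightarrow> v (a' - c e') = min (v (a' - c0 e')) (v (c0 e' - c e'))"
      and pos: "\<And>u. u \<in> U \<Longrightarrow> v (u e) < v (a - c0 e) \<longleftrightarrow> v (u e') < v (a' - c0 e')"
        "\<And>u. u \<in> U \<Longrightarrow> v (a - c0 e) < v (u e) \<longleftrightarrow> v (a' - c0 e') < v (u e')"
      by (rule point_transfer[where a = a, OF \<pi> \<kappa> M N(1,2) U U_diff same1[unfolded W1_def]]) (rule that)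
    have split: "v (s (g(i := b))) = min (v (slope s) + v (b - c0 g)) (v (value_at s c0 g))"
      if s: "s \<in> W" and near: "\<And>c. c \<in> N \<Longrightarrow> v (b - c g) = min (v (b - c0 g)) (v (c0 g - c g))" for s g b
    proof -
      have val: "s (g(i := x)) = s (g(i := 0)) + slope s * x" for x
        using linear_form_upd[of s g i 0 x] W(2) s unfolding slope_def by simp
      show ?thesis
      proof (cases "slope s = 0")
        case True
        thus ?thesis using val[of b] val[of "c0 g"] unfolding value_at_def by (simp add: min_def)
      next
        case False
        have eq: "s (g(i := x)) = slope s * (x - center s g)" for x
          using val[of x] False unfolding center_def by (simp add: field_simps)
        have "center s \<in> N" unfolding N_def using s by blast
        moreover have "v (slope s) + min x y = min (v (slope s) + x) (v (slope s) + y)" for x y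
          by (simp add: min_def add_left_mono) (metis add_left_mono antisym linear)
        ultimately show ?thesis
          using near eq[of b] eq[of "c0 g"] unfolding value_at_def by (simp add: v_mult)
      qed
    qed
    have at_at: "v (value_at s c0 e) < v (value_at t c0 e) \<longleftrightarrow> v (value_at s c0 e') < v (value_at t c0 e')" if "s \<in> W" "t \<in> W" for s t
      using same_orderD[OF same2, of "value_at s c0" "value_at t c0"] that c0 unfolding W2_def by blast
    have inv: "v (slope t) + v (inverse (slope t) * x) = v x" if "slope t \<noteq> 0" for t x
    proof -
      have "slope t * (inverse (slope t) * x) = x" using that by (simp add: mult.assoc[symmetric])
      thus ?thesis by (simp only: v_mult[symmetric])
    qed
    have fin: "v (slope t) \<noteq> \<infinity>" "v (slope t) \<noteq> -\<infinity>" if "slope t \<noteq> 0" for t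
      using that by auto
    have at_slope: "v (value_at s c0 e) < v (slope t) + v (a - c0 e) \<longleftrightarrow> v (value_at s c0 e') < v (slope t) + v (a' - c0 e')"
      if st: "s \<in> W" "t \<in> W" for s t
    proof (cases "slope t = 0")
      case True
      have "v (value_at s c0 e) < v 0 \<longleftrightarrow> v (value_at s c0 e') < v 0"
        using same_orderD[OF same, of "value_at s c0" "\<lambda>_. 0"] st(1) c0 U(2) unfolding W1_def W2_def by blast
      thus ?thesis using True by simp
    next
      case False
      show ?thesis
        using pos(1)[OF U_value[OF st c0]] ereal_add_less_iff[OF fin[OF False]] inv[OF False] by metis
    qed
    have slope_at: "v (slope t) + v (a - c0 e) < v (value_at s c0 e) \<longleftrightarrow> v (slope t) + v (a' - c0 e') < v (value_at s c0 e')"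
      if st: "s \<in> W" "t \<in> W" for s t
    proof (cases "slope t = 0")
      case False
      show ?thesis
        using pos(2)[OF U_value[OF st c0]] ereal_add_less_iff[OF fin[OF False]] inv[OF False] by metis
    qed simp
    have slope_slope: "v (slope s) + v (a - c0 e) < v (slope t) + v (a - c0 e) \<longleftrightarrow>
        v (slope s) + v (a' - c0 e') < v (slope t) + v (a' - c0 e')" for s t
    proof -
      have "a = c0 e \<longleftrightarrow> a' = c0 e'" using pos(2)[OF U(2)] by simp
      moreover have "v (slope s) + v b < v (slope t) + v b \<longleftrightarrow> v (slope s) < v (slope t)" if "b \<noteq> 0" for b
        using ereal_add_less_iff[of "v b" "v (slope s)" "v (slope t)"] that
        by (simp add: add.commute[of _ "v b"])
      ultimately show ?thesis by (cases "a = c0 e") simp_all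
    qed
    have split_e: "v (s (e(i := a))) = min (v (slope s) + v (a - c0 e)) (v (value_at s c0 e))"
      if "s \<in> W" for s using that near(1) by (rule split)
    have split_e': "v (s (e'(i := a'))) = min (v (slope s) + v (a' - c0 e')) (v (value_at s c0 e'))"
      if "s \<in> W" for s using that near(2) by (rule split)
    have "same_order W (e(i := a)) (e'(i := a'))"
      unfolding same_order_def
    proof (intro ballI)
      fix s t assume st: "s \<in> W" "t \<in> W"
      show "v (s (e(i := a))) < v (t (e(i := a))) \<longleftrightarrow> v (s (e'(i := a'))) < v (t (e'(i := a')))"
        by (simp only: split_e split_e' min_less_min_iff at_at at_slope slope_at slope_slope st)
    qed
    thus ?thesis ..
  qed
  ultimately show ?thesis by (intro exI[of _ "W1 \<union> W2"]) blast
qed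

definition order_determined :: "((nat \<Rightarrow> 'a) \<Rightarrow> bool) \<Rightarrow> bool" where
  "order_determined P \<longleftrightarrow> (\<exists>W. finite W \<and> (\<forall>s\<in>W. linear_form s) \<and>
     (\<forall>e e'. same_order W e e' \<longrightarrow> (P e \<longleftrightarrow> P e')))"

text \<open>
  Equality of two terms is a comparison as well: it says that the value of their difference is not
  below \<open>v 0 = \<infinity>\<close>.
\<close>
theorem order_determined_lsat:
  assumes \<pi>: "0 < v \<pi>" "\<pi> \<noteq> 0"
  shows "order_determined (\<lambda>e. lsat v e \<phi>)"
proof (induction \<phi>)
  case (LEq s u)
  let ?f = "\<lambda>e. lterm_val e s - lterm_val e u"
  have "lsat v e (LEq s u) \<longleftrightarrow> \<not> v (?f e) < v 0" for e by simp
  thus ?case unfolding order_determined_def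
    by (intro exI[of _ "{?f, \<lambda>_. 0}"])
      (auto simp: same_order_def intro!: linear_form_diff linear_form_lterm linear_form_zero)
next
  case (LLess s u)
  show ?case unfolding order_determined_def
    by (intro exI[of _ "{\<lambda>e. lterm_val e s, \<lambda>e. lterm_val e u}"])
      (auto simp: same_order_def intro!: linear_form_lterm)
next
  case (LNeg \<phi>)
  thus ?case unfolding order_determined_def by simp
next
  case (LConj \<phi> \<psi>)
  then obtain W W' where W: "finite W" "\<forall>s\<in>W. linear_form s"
      "\<And>e e'. same_order W e e' \<Longrightarrow> lsat v e \<phi> \<longleftrightarrow> lsat v e' \<phi>"
    and W': "finite W'" "\<forall>s\<in>W'. linear_form s"
      "\<And>e e'. same_order W' e e' \<Longrightarrow> lsat v e \<psi> \<longleftrightarrow> lsat v e' \<psi>"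
    unfolding order_determined_def by blast
  have "lsat v e (LConj \<phi> \<psi>) \<longleftrightarrow> lsat v e' (LConj \<phi> \<psi>)" if "same_order (W \<union> W') e e'" for e e'
    using W(3)[of e e'] W'(3)[of e e'] same_order_mono[OF that] by simp
  thus ?case unfolding order_determined_def
    using W(1,2) W'(1,2) by (intro exI[of _ "W \<union> W'"]) blast
next
  case (LEx i \<phi>)
  then obtain W where W: "finite W" "\<forall>s\<in>W. linear_form s"
      "\<And>e e'. same_order W e e' \<Longrightarrow> lsat v e \<phi> \<longleftrightarrow> lsat v e' \<phi>"
    unfolding order_determined_def by blast
  obtain W' where W': "finite W'" "\<forall>s\<in>W'. linear_form s"
      "\<And>e e' a. same_order W' e e' \<Longrightarrow> \<exists>a'. same_order W (e(i := a)) (e'(i := a'))"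
    using eliminate_variable[OF \<pi> W(1,2), of i] by blast
  have "lsat v e' (LEx i \<phi>)" if same: "same_order W' e e'" and sat: "lsat v e (LEx i \<phi>)" for e e'
  proof -
    obtain a where "lsat v (e(i := a)) \<phi>" using sat by auto
    moreover obtain a' where "same_order W (e(i := a)) (e'(i := a'))" using W'(3)[OF same] by blast
    ultimately have "lsat v (e'(i := a')) \<phi>" using W(3) by blast
    thus ?thesis by auto
  qed
  hence "same_order W' e e' \<longrightarrow> (lsat v e (LEx i \<phi>) \<longleftrightarrow> lsat v e' (LEx i \<phi>))" for e e'
    using same_order_sym by blast
  thus ?case unfolding order_determined_def using W'(1,2) by (intro exI[of _ W']) blast
qed

end

section \<open>Definable relations\<close>

context valued
begin

text \<open>
  The pattern of all comparisons among the forms in \<open>W\<close> decides \<open>P\<close>. Each pattern cuts out an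
  intersection of \<open>card (W \<times> W)\<close> comparisons or their negations, and there are at most
  \<open>2 ^ card (W \<times> W)\<close> patterns. The coefficient \<open>192\<close> collects \<open>2\<close> for the patterns, \<open>2\<close> for the two
  signs, \<open>16\<close> from the comparison and \<open>3\<close> from \<open>2 * k + 3 \<le> 3 * (k + 1)\<close>.
\<close>
lemma range_tree_order_determined:
  fixes sh :: "'x \<Rightarrow> nat \<Rightarrow> 'a"
  assumes W: "finite W" "\<forall>s\<in>W. linear_form s"
    and P: "\<forall>e e'. same_order W e e' \<longrightarrow> (P e \<longleftrightarrow> P e')"
    and A: "finite A" "card A \<le> 2 ^ k"
  shows "range_tree A ((192 * (k + 1) ^ 5) ^ card (W \<times> W)) {{z\<in>A. P (\<lambda>i. y i + sh z i)} |y. True}"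
proof -
  define J where "J = W \<times> W"
  define q where "q = 16 * (k + 1) ^ 4 * (2 * k + 3)"
  define \<Q> where "\<Q> = (\<lambda>(s, t). {(\<lambda>z. R (v (s (sh z) - a)) (v (t (sh z) - b))) |R a b. R = (<) \<or> R = (\<ge>)})"
  define \<F> where "\<F> = {{z\<in>A. \<forall>j\<in>J. Q j z} |Q. \<forall>j\<in>J. Q j \<in> \<Q> j}"
  have J: "finite J" unfolding J_def using W(1) by simp
  have "range_tree S (q + q) {{z\<in>S. Q z} |Q. Q \<in> \<Q> j}" if "S \<subseteq> A" for S j
  proof -
    have S: "finite S" "card S \<le> 2 ^ k"
      using finite_subset[OF that A(1)] card_mono[OF A(1) that] A(2) by auto
    obtain s t where j: "j = (s, t)" by (cases j)
    let ?L = "\<lambda>R. {{z\<in>S. R (v (s (sh z) - a)) (v (t (sh z) - b))} |a b. True}"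
    have L: "range_tree S q (?L R)" if "R = (<) \<or> R = (\<ge>)" for R
      unfolding q_def by (rule range_tree_compare[OF S that])
    show ?thesis
    proof (rule range_tree_Un[OF L[of "(<)"] L[of "(\<ge>)"]])
      fix H assume "H \<in> {{z\<in>S. Q z} |Q. Q \<in> \<Q> j}"
      then obtain R a b where H: "R = (<) \<or> R = (\<ge>)"
          "H = {z\<in>S. R (v (s (sh z) - a)) (v (t (sh z) - b))}"
        unfolding \<Q>_def j by auto
      hence "H \<in> ?L (<) \<or> H \<in> ?L (\<ge>)" by blast
      thus "\<exists>F\<in>insert {} (?L (<)). \<exists>G\<in>insert {} (?L (\<ge>)). H = F \<union> G"
        by (metis (no_types, lifting) Un_empty_left Un_empty_right insertCI)
    qed simp_all
  qed
  hence "range_tree A ((q + q) ^ card J) \<F>"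
    unfolding \<F>_def by (intro range_tree_Inter[OF J _ A(1)]) blast
  hence "range_tree A (2 ^ card J * (q + q) ^ card J) {{z\<in>A. P (\<lambda>i. y i + sh z i)} |y. True}"
  proof (rule range_tree_Union)
    fix H assume "H \<in> {{z\<in>A. P (\<lambda>i. y i + sh z i)} |y. True}"
    then obtain y where H: "H = {z\<in>A. P (\<lambda>i. y i + sh z i)}" by blast
    define less where "less = (\<lambda>(s, t) z. v (s (\<lambda>i. y i + sh z i)) < v (t (\<lambda>i. y i + sh z i)))"
    define cell where "cell = (\<lambda>\<pi>. {z\<in>A. \<forall>j\<in>J. less j z \<longleftrightarrow> j \<in> \<pi>})"
    define pattern where "pattern = (\<lambda>z. {j\<in>J. less j z})"
    have cell: "cell \<pi> \<in> \<F>" for \<pi>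
    proof -
      define Q where "Q = (\<lambda>(s, t) z. (if (s, t) \<in> \<pi> then (<) else (\<ge>))
          (v (s (sh z) - (- s y))) (v (t (sh z) - (- t y))))"
      have "Q j \<in> \<Q> j" for j
      proof -
        obtain s t where j: "j = (s, t)" by (cases j)
        show ?thesis unfolding Q_def \<Q>_def j prod.case
          by (intro CollectI exI[of _ "if (s, t) \<in> \<pi> then (<) else (\<ge>)"]
              exI[of _ "- s y"] exI[of _ "- t y"] conjI refl) simp
      qed
      moreover have "(less j z \<longleftrightarrow> j \<in> \<pi>) \<longleftrightarrow> Q j z" if "j \<in> J" for j z
        using that W(2) unfolding J_def less_def Q_def
        by (auto simp: linear_form_def not_less add.commute split: if_splits)
      ultimately show ?thesis unfolding cell_def \<F>_def by auto
    qed
    have det: "P (\<lambda>i. y i + sh z' i)" if "z \<in> H" "z' \<in> cell (pattern z)" for z z'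
    proof -
      have "\<forall>j\<in>J. less j z' \<longleftrightarrow> less j z" using that(2) unfolding cell_def pattern_def by blast
      hence "same_order W (\<lambda>i. y i + sh z i) (\<lambda>i. y i + sh z' i)"
        unfolding same_order_def J_def less_def by auto
      thus ?thesis using P that(1) unfolding H by blast
    qed
    have "z \<in> cell (pattern z)" if "z \<in> H" for z
      using that unfolding cell_def pattern_def H by blast
    moreover have "cell \<pi> \<subseteq> A" for \<pi> unfolding cell_def by blast
    ultimately have HU: "H = \<Union>(cell ` pattern ` H)"
      using det unfolding H by blast
    have "pattern ` H \<subseteq> Pow J" unfolding pattern_def by blast
    hence "card (pattern ` H) \<le> 2 ^ card J" "finite (pattern ` H)"
      using card_mono[of "Pow J" "pattern ` H"] finite_subset[of "pattern ` H" "Pow J"] J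
      by (simp_all add: card_Pow)
    hence "finite (cell ` pattern ` H)" "card (cell ` pattern ` H) \<le> 2 ^ card J"
      using card_image_le[of "pattern ` H" cell] by auto
    thus "\<exists>\<F>'\<subseteq>\<F>. finite \<F>' \<and> card \<F>' \<le> 2 ^ card J \<and> H = \<Union>\<F>'"
      using HU cell by (intro exI[of _ "cell ` pattern ` H"] conjI image_subsetI)
  qed simp
  moreover have "2 ^ card J * (q + q) ^ card J \<le> (192 * (k + 1) ^ 5) ^ card J"
  proof -
    have "2 * (q + q) = 64 * (k + 1) ^ 4 * (2 * k + 3)" unfolding q_def by simp
    also have "\<dots> \<le> 64 * (k + 1) ^ 4 * (3 * (k + 1))" by (intro mult_le_mono2) simp
    also have "64 * m ^ 4 * (3 * m) = 192 * m ^ 5" for m :: nat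
      using power_Suc[of m 4] by (simp add: mult_ac)
    finally show ?thesis by (simp only: power_mult_distrib[symmetric] power_mono)
  qed
  ultimately show ?thesis unfolding J_def using range_tree_mono[OF _ order_refl] by blast
qed

text \<open>
  The assignment depends additively on each point, which occupies a block of variables; so every
  linear form splits into a function of the free point and a constant.
\<close>
lemma assignment_upd:
  fixes y :: "nat \<Rightarrow> 'a list"
  assumes j: "j < r" and y: "\<And>i. i < j \<Longrightarrow> length (y i) = d i" and z: "length z = d j"
  defines "off \<equiv> \<Sum>i<j. d i"
  shows "assignment (concat (map (y(j := z)) [0..<r])) b =
    (\<lambda>i. assignment (concat (map (y(j := replicate (d j) 0)) [0..<r])) b i +
         (if off \<le> i \<and> i < off + d j then z ! (i - off) else 0))"
proof -
  define pre post where "pre = concat (map y [0..<j])" and "post = concat (map y [Suc j..<r])"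
  have "[0..<r] = [0..<j] @ j # [Suc j..<r]"
    using j upt_add_eq_append[of 0 j "r - j"] upt_conv_Cons[of j r] by simp
  moreover have "map (y(j := w)) [0..<j] = map y [0..<j]" "map (y(j := w)) [Suc j..<r] = map y [Suc j..<r]" for w
    by auto
  ultimately have split: "concat (map (y(j := w)) [0..<r]) = pre @ w @ post" for w
    unfolding pre_def post_def by simp
  have "length pre = (\<Sum>i\<leftarrow>[0..<j]. length (y i))" unfolding pre_def by (simp add: length_concat comp_def)
  also have "\<dots> = off" unfolding off_def using y
    by (simp add: interv_sum_list_conv_sum_set_nat atLeast0LessThan)
  finally have "length pre = off" .
  thus ?thesis unfolding split using z
    by (auto simp: fun_eq_iff assignment_def nth_append)
qed

lemma range_tree_fibres_definable:
  assumes "order_determined (\<lambda>e. lsat v e \<phi>)"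
  shows "\<exists>w. \<forall>r d b k. range_tree_fibres r (\<lambda>j. Kpow (d j))
    (\<lambda>x. lsat v (assignment (concat (map x [0..<r])) b) \<phi>) (2 ^ k) ((192 * (k + 1) ^ 5) ^ w)"
proof -
  obtain W where W: "finite W" "\<forall>s\<in>W. linear_form s"
      "\<forall>e e'. same_order W e e' \<longrightarrow> (lsat v e \<phi> \<longleftrightarrow> lsat v e' \<phi>)"
    using assms unfolding order_determined_def by blast
  have "range_tree A ((192 * (k + 1) ^ 5) ^ card (W \<times> W))
      {{z\<in>A. lsat v (assignment (concat (map (y(j := z)) [0..<r])) b) \<phi>} |y. y \<in> (\<Pi>\<^sub>E i\<in>{..<r}. Kpow (d i))}"
    if j: "j < r" and A: "A \<subseteq> Kpow (d j)" "finite A" "card A \<le> 2 ^ k"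
    for r and d :: "nat \<Rightarrow> nat" and b k j and A :: "'a list set"
  proof -
    define sh where "sh = (\<lambda>(z :: 'a list) i. if (\<Sum>i<j. d i) \<le> i \<and> i < (\<Sum>i<j. d i) + d j
        then z ! (i - (\<Sum>i<j. d i)) else 0)"
    have "{z\<in>A. lsat v (assignment (concat (map (y(j := z)) [0..<r])) b) \<phi>} =
        {z\<in>A. lsat v (\<lambda>i. assignment (concat (map (y(j := replicate (d j) 0)) [0..<r])) b i + sh z i) \<phi>}"
      if y: "y \<in> (\<Pi>\<^sub>E i\<in>{..<r}. Kpow (d i))" for y
    proof (rule Collect_cong, rule conj_cong[OF refl])
      fix z assume "z \<in> A"
      hence "length z = d j" using A(1) by (auto simp: Kpow_def)
      moreover have "length (y i) = d i" if "i < j" for i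
        using y that j unfolding PiE_iff Kpow_def by auto
      ultimately show "lsat v (assignment (concat (map (y(j := z)) [0..<r])) b) \<phi> =
          lsat v (\<lambda>i. assignment (concat (map (y(j := replicate (d j) 0)) [0..<r])) b i + sh z i) \<phi>"
        using assignment_upd[OF j, of y d z b] unfolding sh_def by simp
    qed
    thus ?thesis
      by (intro range_tree_subset[OF range_tree_order_determined[OF W A(2,3), of sh]]) blast
  qed
  thus ?thesis unfolding range_tree_fibres_def by blast
qed

end

theorem corollary6p13:
  fixes p r t :: nat
    and v :: "'a::field_char_0 \<Rightarrow> ereal"
    and d :: "nat \<Rightarrow> nat"
    and \<phi> :: "'a lform"
  assumes "prime p"
    and "is_Qp p v \<or> is_Cp p v"
    and "r \<ge> 2" and "t \<ge> 2"
  shows "\<exists>C c :: real. \<forall>R. defined_by v r d \<phi> R \<longrightarrow>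
    (\<forall>B. (\<forall>j<r. finite (B j) \<and> B j \<subseteq> Kpow (d j)) \<longrightarrow>
      (let E = R \<inter> (\<Pi>\<^sub>E j\<in>{..<r}. B j);
           n = (\<Sum>j<r. card (B j))
       in K_free r t B E \<longrightarrow>
          real (card E) \<le> C * (real n ^ (r - 1) * ln (real n) powr c)))"
proof -
  have padic: "padic_valuation p v" using assms(2) unfolding is_Qp_def is_Cp_def by blast
  interpret valued v using padic unfolding padic_valuation_def by unfold_locales blast
  have "v (of_nat p) = ereal (real (multiplicity p p))"
    using padic assms(1) prime_gt_0_nat unfolding padic_valuation_def by blast
  hence vp: "0 < v (of_nat p)" "of_nat p \<noteq> (0 :: 'a)"
    using assms(1) prime_gt_0_nat by (auto simp: multiplicity_same_power)
  obtain w where w: "\<And>b k. range_tree_fibres r (\<lambda>j. Kpow (d j))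
      (\<lambda>x. lsat v (assignment (concat (map x [0..<r])) b) \<phi>) (2 ^ k) ((192 * (k + 1) ^ 5) ^ w)"
    using range_tree_fibres_definable[OF order_determined_lsat[OF vp, of \<phi>]] by blast
  define N where "N = w * polylog_exponent t r"
  define C :: real where "C = r * t * 192 ^ N * (3 / ln 2) ^ (5 * N)"
  define c :: real where "c = real (5 * N)"
  have bound: "real (card E) \<le> C * (real n ^ (r - 1) * ln (real n) powr c)"
    if R: "defined_by v r d \<phi> R"
      and B: "\<And>j. j < r \<Longrightarrow> finite (B j) \<and> B j \<subseteq> Kpow (d j)"
      and E: "E = R \<inter> (\<Pi>\<^sub>E j\<in>{..<r}. B j)" and n: "n = (\<Sum>j<r. card (B j))"
      and free: "K_free r t B E" for R B E n
  proof (cases "n \<ge> 2")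
    case False
    (* For n < 2 the logarithm vanishes, but with r >= 2 some vertex set is empty. *)
    have "\<exists>j<r. card (B j) = 0"
    proof (rule ccontr)
      assume "\<not> ?thesis"
      hence "(\<Sum>j<r. 1) \<le> n" unfolding n by (intro sum_mono) (simp add: Suc_le_eq)
      thus False using False assms(3) by simp
    qed
    hence "\<exists>j<r. B j = {}" using B by auto
    hence "E = {}" unfolding E by (auto simp: PiE_eq_empty_iff)
    moreover have "0 \<le> C" unfolding C_def by simp
    ultimately show ?thesis by simp
  next
    case True
    obtain b where b: "R = relation_of v r d \<phi> b" using R unfolding defined_by_def by blast
    define P where "P = (\<lambda>x. lsat v (assignment (concat (map x [0..<r])) b) \<phi>)"
    have E': "E = {x \<in> (\<Pi>\<^sub>E j\<in>{..<r}. B j). P x}"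
    proof -
      have "(\<Pi>\<^sub>E j\<in>{..<r}. B j) \<subseteq> (\<Pi>\<^sub>E j\<in>{..<r}. Kpow (d j))" using B by (intro PiE_mono) auto
      thus ?thesis unfolding E b relation_of_def P_def by blast
    qed
    obtain k0 where k0: "2 ^ k0 \<le> n" "n < 2 ^ (k0 + 1)" using ex_power_ivl1[of 2 n] True by auto
    define k where "k = k0 + 1"
    define q where "q = (192 * (k + 1) ^ 5) ^ w"
    have "n * card E \<le> r * t * q ^ polylog_exponent t r * n ^ r"
      unfolding E'
    proof (rule card_K_free_le)
      show "1 \<le> q" unfolding q_def by simp
      show "n \<le> 2 ^ k" using k0(2) unfolding k_def by simp
      show "finite (B j) \<and> B j \<subseteq> Kpow (d j) \<and> card (B j) \<le> n" if "j < r" for j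
        using B[OF that] that unfolding n by (auto intro: member_le_sum[of j _ "\<lambda>j. card (B j)"])
      show "range_tree_fibres r (\<lambda>j. Kpow (d j)) P (2 ^ k) q" unfolding P_def q_def by (rule w)
      show "K_free r t B {x \<in> (\<Pi>\<^sub>E j\<in>{..<r}. B j). P x}" using free unfolding E' .
    qed
    also have "n ^ r = n * n ^ (r - 1)" using assms(3) by (cases r) auto
    finally have "n * card E \<le> n * (r * t * q ^ polylog_exponent t r * n ^ (r - 1))" by (simp add: mult_ac)
    hence "card E \<le> r * t * q ^ polylog_exponent t r * n ^ (r - 1)" using True by simp
    hence 1: "real (card E) \<le> r * t * real q ^ polylog_exponent t r * real n ^ (r - 1)"
      by (metis (no_types, lifting) of_nat_le_iff of_nat_mult of_nat_power)
    have ln_n: "ln 2 \<le> ln (real n)" "0 < ln (real n)" using True by auto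
    have "real k0 * ln 2 = ln (2 ^ k0)" by (simp add: ln_realpow)
    also have "\<dots> \<le> ln (real n)" using k0(1) True by (subst ln_le_cancel_iff) (auto simp flip: of_nat_power)
    finally have "real (k + 1) * ln 2 \<le> 3 * ln (real n)" using ln_n unfolding k_def by (simp add: algebra_simps)
    hence k: "real (k + 1) \<le> 3 / ln 2 * ln (real n)" by (simp add: field_simps)
    have "real q ^ polylog_exponent t r = 192 ^ N * real (k + 1) ^ (5 * N)"
      unfolding q_def N_def by (simp add: power_mult_distrib power_mult[symmetric] mult_ac del: of_nat_add)
    also have "\<dots> \<le> 192 ^ N * (3 / ln 2 * ln (real n)) ^ (5 * N)"
      using k by (intro mult_left_mono power_mono) auto
    also have "\<dots> = 192 ^ N * (3 / ln 2) ^ (5 * N) * ln (real n) powr c"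
      unfolding c_def using ln_n(2) by (simp only: powr_realpow power_mult_distrib mult.assoc)
    finally have q: "real q ^ polylog_exponent t r \<le> 192 ^ N * (3 / ln 2) ^ (5 * N) * ln (real n) powr c" .
    have "real (card E) \<le> r * t * (192 ^ N * (3 / ln 2) ^ (5 * N) * ln (real n) powr c) * real n ^ (r - 1)"
      using 1 by (rule order_trans) (intro mult_right_mono mult_left_mono q; simp)
    thus ?thesis unfolding C_def by (simp add: mult_ac)
  qed
  show ?thesis
    unfolding Let_def
  proof (rule exI[of _ C], rule exI[of _ c], intro allI impI)
    fix R B assume "defined_by v r d \<phi> R" "\<forall>j<r. finite (B j) \<and> B j \<subseteq> Kpow (d j)"
      "K_free r t B (R \<inter> (\<Pi>\<^sub>E j\<in>{..<r}. B j))"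
    thus "real (card (R \<inter> (\<Pi>\<^sub>E j\<in>{..<r}. B j))) \<le>
        C * (real (\<Sum>j<r. card (B j)) ^ (r - 1) * ln (real (\<Sum>j<r. card (B j))) powr c)"
      by (intro bound[OF _ _ refl refl]) simp_all
  qed
qed

end
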